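(* Let $c>1$ and let $\{Y_n\}_{n\ge 0}$ be the once-reinforced random walk with parameter $c$ on the tree ${\bf T}$. Let $S$ be its speed. Then for every $\epsilon>0$ there exists a finite positive number $\beta=\beta(c,b,\epsilon)$ such that $$\lim_{n\to\infty}\frac{-1}{n}\log {\bf P}\big(h(Y_n)\ge (S+\epsilon)n\big)=\beta .$$
   Context: Let $b\ge 2$. ${\bf T}$ is the infinite tree in which every vertex has $b+1$ neighbors, except one vertex, the root ${\bf 0}$, which has $b$ neighbors. $h(x)$ denotes the number of edges on the path from the root to the vertex $x$. Once-reinforced random walk with parameter $c>1$: $Y_0={\bf 0}$; every edge has initial weight $1$. Given the history up to time $i$, $Y_{i+1}$ is a neighbor of $Y_i$ chosen with probability proportional to the current weights of the edges incident to $Y_i$. An edge has weight $1$ as long as it has never been traversed, and weight $c$ from its first traversal (in either direction) on. Speed: it is known that for every $c>1$ there is a constant $S=S(c)$ (for the given $b$) with $0<S<b/(b+c)$ such that $\lim_{n\to\infty} h(Y_n)/n=S$ almost surely.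
   Formalization: The claim is proved for every ε > 0 with S + ε ≤ 1; for S + ε > 1 the event h(Y_n) ≥ (S+ε)n is empty for n ≥ 1 since h(Y_n) ≤ n, so no finite β exists there. *)

theory Defs
  imports "HOL-Probability.Probability"
begin

text \<open>
  Vertices of the tree are encoded as words over \<open>{..<b}\<close>: the list of child indices read along the
  path from the root, the last step first. The root is \<open>[]\<close>, the children of \<open>x\<close> are \<open>i # x\<close>
  for \<open>i < b\<close>, and the parent of \<open>x \<noteq> []\<close> is \<open>tl x\<close>.
\<close>

type_synonym vertex = "nat list"

definition neighbours :: "nat \<Rightarrow> vertex \<Rightarrow> vertex set" where
  "neighbours b x = (\<lambda>i. i # x) ` {..<b} \<union> (if x = [] then {} else {tl x})"

definition height :: "vertex \<Rightarrow> nat" where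
  "height x = length x"

lemma finite_neighbours [simp]: "finite (neighbours b x)"
  by (simp add: neighbours_def)

lemma card_neighbours: "card (neighbours b x) = (if x = [] then b else b + 1)"
proof -
  have "tl x \<notin> (\<lambda>i. i # x) ` {..<b}"
    by (auto dest: arg_cong[where f = length])
  moreover have "card ((\<lambda>i. i # x) ` {..<b}) = b"
    by (subst card_image) (auto simp: inj_on_def)
  ultimately show ?thesis
    by (auto simp: neighbours_def)
qed

text \<open>
  The weight at time \<open>n\<close> of the undirected edge \<open>{x, y}\<close>, and the probability that
  \<open>\<omega> (Suc n) = y\<close> given the history \<open>\<omega> 0, \<dots>, \<omega> n\<close>.
\<close>

definition edge_weight :: "real \<Rightarrow> (nat \<Rightarrow> vertex) \<Rightarrow> nat \<Rightarrow> vertex \<Rightarrow> vertex \<Rightarrow> real" where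
  "edge_weight c \<omega> n x y = (if \<exists>i<n. {\<omega> i, \<omega> (Suc i)} = {x, y} then c else 1)"

definition step_prob :: "nat \<Rightarrow> real \<Rightarrow> (nat \<Rightarrow> vertex) \<Rightarrow> nat \<Rightarrow> vertex \<Rightarrow> real" where
  "step_prob b c \<omega> n y =
     (if y \<in> neighbours b (\<omega> n)
      then edge_weight c \<omega> n (\<omega> n) y / (\<Sum>z\<in>neighbours b (\<omega> n). edge_weight c \<omega> n (\<omega> n) z)
      else 0)"

text \<open>
  \<open>orrw_step b c i \<omega>\<close> is the law of the \<open>i\<close>-th position given the positions before time \<open>i\<close>.
\<close>

primrec orrw_step :: "nat \<Rightarrow> real \<Rightarrow> nat \<Rightarrow> (nat \<Rightarrow> vertex) \<Rightarrow> vertex pmf" where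
  "orrw_step b c 0 \<omega> = return_pmf []"
| "orrw_step b c (Suc n) \<omega> = embed_pmf (step_prob b c \<omega> n)"

lemma edge_weight_pos: "c > 0 \<Longrightarrow> edge_weight c \<omega> n x y > 0"
  by (simp add: edge_weight_def)

lemma pmf_orrw_step_Suc:
  assumes "b \<ge> 1" "c > 0"
  shows "pmf (orrw_step b c (Suc n) \<omega>) y = step_prob b c \<omega> n y"
proof -
  let ?N = "neighbours b (\<omega> n)" and ?w = "edge_weight c \<omega> n (\<omega> n)"
  have ne: "?N \<noteq> {}"
    using assms card_neighbours[of b "\<omega> n"] by (auto split: if_splits)
  have pos: "(\<Sum>z\<in>?N. ?w z) > 0"
    using ne edge_weight_pos[OF assms(2)] by (intro sum_pos) auto
  have nonneg: "step_prob b c \<omega> n z \<ge> 0" for z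
    using pos edge_weight_pos[OF assms(2)] by (auto simp: step_prob_def intro!: divide_nonneg_pos less_imp_le)
  have "(\<integral>\<^sup>+z. ennreal (step_prob b c \<omega> n z) \<partial>count_space UNIV)
      = (\<Sum>z\<in>?N. ennreal (step_prob b c \<omega> n z))"
    by (intro nn_integral_count_space') (auto simp: step_prob_def)
  also have "\<dots> = ennreal (\<Sum>z\<in>?N. step_prob b c \<omega> n z)"
    using nonneg by (intro sum_ennreal) auto
  also have "(\<Sum>z\<in>?N. step_prob b c \<omega> n z) = 1"
    using pos by (simp add: step_prob_def sum_divide_distrib[symmetric])
  finally show ?thesis
    using nonneg by (simp add: pmf_embed_pmf)
qed

interpretation orrw_IT: Ionescu_Tulcea
  "\<lambda>i \<omega>. measure_pmf (orrw_step b c i \<omega>)" "\<lambda>_. count_space UNIV" for b c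
proof
  fix i :: nat
  have "PiM {0..<i} (\<lambda>_. count_space (UNIV :: vertex set)) = count_space (PiE {0..<i} (\<lambda>_. UNIV))"
    by (rule count_space_PiM_finite) auto
  then show "(\<lambda>\<omega>. measure_pmf (orrw_step b c i \<omega>))
      \<in> PiM {0..<i} (\<lambda>_. count_space UNIV) \<rightarrow>\<^sub>M subprob_algebra (count_space UNIV)"
    by (simp add: measure_pmf_in_subprob_algebra)
qed

text \<open>The law of the walk on trajectory space; the walk itself is the coordinate process.\<close>

definition orrw :: "nat \<Rightarrow> real \<Rightarrow> (nat \<Rightarrow> vertex) measure" where
  "orrw b c = projective_family.lim UNIV
     (Ionescu_Tulcea.CI (\<lambda>i \<omega>. measure_pmf (orrw_step b c i \<omega>)) (\<lambda>_. count_space UNIV))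
     (\<lambda>_. count_space UNIV)"

lemma sets_orrw [measurable_cong, simp]: "sets (orrw b c) = sets (PiM UNIV (\<lambda>_. count_space UNIV))"
  unfolding orrw_def by (rule orrw_IT.PF.sets_lim)

lemma space_orrw [simp]: "space (orrw b c) = UNIV"
  by (simp add: sets_eq_imp_space_eq[OF sets_orrw] space_PiM)

lemma orrw_step_cong:
  assumes "\<And>j. j < i \<Longrightarrow> \<omega> j = \<omega>' j"
  shows "orrw_step b c i \<omega> = orrw_step b c i \<omega>'"
proof (cases i)
  case (Suc n)
  have "edge_weight c \<omega> n = edge_weight c \<omega>' n" "\<omega> n = \<omega>' n"
    using assms Suc by (auto simp: edge_weight_def fun_eq_iff)
  then have "step_prob b c \<omega> n = step_prob b c \<omega>' n"
    by (simp add: step_prob_def fun_eq_iff)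
  with Suc show ?thesis by simp
qed simp

lemma emeasure_C_singleton:
  "emeasure (orrw_IT.C b c 0 n (\<lambda>_. undefined)) {restrict x {0..<n}}
     = (\<Prod>i<n. ennreal (pmf (orrw_step b c i x) (x i)))"
proof (induction n)
  case 0
  show ?case by (simp add: restrict_def space_PiM emeasure_return PiM_empty)
next
  case (Suc n)
  let ?M = "\<lambda>_::nat. count_space (UNIV :: vertex set)"
  let ?C = "orrw_IT.C b c 0 n (\<lambda>_. undefined)"
  let ?x = "\<lambda>n. restrict x {0..<n}"
  have M: "PiM {0..<n} ?M = count_space (PiE {0..<n} (\<lambda>_. UNIV))" for n
    by (rule count_space_PiM_finite) auto
  have u: "(\<lambda>_. undefined) \<in> space (PiM {0..<0} ?M)"
    by (simp add: space_PiM)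
  have sets_C: "sets ?C = sets (PiM {0..<n} ?M)"
    using orrw_IT.sets_C[OF u] by simp
  have space_C: "space ?C = space (PiM {0..<n} ?M)"
    using orrw_IT.space_C[OF u] by simp
  have S: "{?x (Suc n)} \<in> sets (PiM {0..<Suc n} ?M)"
    by (simp add: M PiE_iff)
  have eP: "emeasure (orrw_IT.eP b c n \<omega>) {?x (Suc n)}
      = ennreal (pmf (orrw_step b c n x) (x n)) * indicator {?x n} \<omega>"
    if \<omega>: "\<omega> \<in> space (PiM {0..<n} ?M)" for \<omega>
  proof -
    have ext: "\<omega> j = undefined" if "\<not> j < n" for j
      using \<omega> that by (auto simp: space_PiM PiE_def extensional_def)
    have eq: "fun_upd \<omega> n y = ?x (Suc n) \<longleftrightarrow> \<omega> = ?x n \<and> y = x n" for y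
    proof
      assume *: "fun_upd \<omega> n y = ?x (Suc n)"
      have "\<omega> j = ?x n j" for j
        using fun_cong[OF *, of j] ext[of j] by (cases "j < n") (auto split: if_splits)
      moreover have "y = x n"
        using fun_cong[OF *, of n] by simp
      ultimately show "\<omega> = ?x n \<and> y = x n" by auto
    qed (auto simp: fun_eq_iff)
    have "emeasure (orrw_IT.eP b c n \<omega>) {?x (Suc n)}
        = emeasure (measure_pmf (orrw_step b c n \<omega>)) {y. fun_upd \<omega> n y = ?x (Suc n)}"
      by (subst orrw_IT.emeasure_eP[OF \<omega> S]) (auto intro!: arg_cong2[where f = emeasure])
    also have "{y. fun_upd \<omega> n y = ?x (Suc n)} = (if \<omega> = ?x n then {x n} else {})"
      unfolding eq by auto
    also have "emeasure (measure_pmf (orrw_step b c n \<omega>)) \<dots>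
        = ennreal (pmf (orrw_step b c n x) (x n)) * indicator {?x n} \<omega>"
    proof -
      have "orrw_step b c n (?x n) = orrw_step b c n x"
        by (rule orrw_step_cong) simp
      then show ?thesis
        by (auto simp: emeasure_pmf_single simp del: restrict_apply split: split_indicator)
    qed
    finally show ?thesis .
  qed
  have "emeasure (orrw_IT.C b c 0 (Suc n) (\<lambda>_. undefined)) {?x (Suc n)}
      = emeasure (?C \<bind> orrw_IT.eP b c n) {?x (Suc n)}"
    by simp
  also have "\<dots> = (\<integral>\<^sup>+\<omega>. emeasure (orrw_IT.eP b c n \<omega>) {?x (Suc n)} \<partial>?C)"
    using orrw_IT.measurable_eP S
    by (intro emeasure_bind[where N = "PiM {0..<Suc n} ?M"])
       (auto simp: space_C measurable_cong_sets[OF sets_C refl] space_PiM_empty_iff)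
  also have "\<dots> = (\<integral>\<^sup>+\<omega>. ennreal (pmf (orrw_step b c n x) (x n)) * indicator {?x n} \<omega> \<partial>?C)"
    by (intro nn_integral_cong eP) (simp add: space_C)
  also have "\<dots> = ennreal (pmf (orrw_step b c n x) (x n)) * emeasure ?C {?x n}"
    by (intro nn_integral_cmult_indicator) (simp add: sets_C M PiE_iff)
  finally show ?case
    by (simp only: Suc.IH mult.commute prod.lessThan_Suc)
qed

lemma prob_space_orrw: "prob_space (orrw b c)"
proof
  have "emeasure (orrw b c) (prod_emb UNIV (\<lambda>_. count_space UNIV) {} {\<lambda>_. undefined}) = 1"
    using orrw_IT.lim[of "{}" "{\<lambda>_. undefined}" b c] orrw_IT.emeasure_CI[of "{}" 0 "{\<lambda>_. undefined}" b c]
    by (simp add: orrw_def PiM_empty prod_emb_def)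
  then show "emeasure (orrw b c) (space (orrw b c)) = 1"
    by (simp add: prod_emb_def space_PiM restrict_def)
qed

text \<open>
  The finite-dimensional distributions: the walk starts at the root and, given the history, moves
  according to \<open>step_prob\<close>.
\<close>

lemma emeasure_orrw_cylinder:
  assumes "b \<ge> 1" "c > 0"
  shows "emeasure (orrw b c) {\<omega>. \<forall>i\<le>n. \<omega> i = x i}
     = ennreal (if x 0 = [] then \<Prod>i<n. step_prob b c x i (x (Suc i)) else 0)"
proof -
  let ?M = "\<lambda>_::nat. count_space (UNIV :: vertex set)"
  let ?J = "{0..<Suc n}"
  have M: "PiM ?J ?M = count_space (PiE ?J (\<lambda>_. UNIV))"
    by (rule count_space_PiM_finite) auto
  have X: "{restrict x ?J} \<in> sets (PiM ?J ?M)"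
    by (simp add: M PiE_iff)
  have "{\<omega>. \<forall>i\<le>n. \<omega> i = x i} = prod_emb UNIV ?M ?J {restrict x ?J}"
    by (auto simp: prod_emb_def space_PiM restrict_def less_Suc_eq_le fun_eq_iff; metis)
  then have "emeasure (orrw b c) {\<omega>. \<forall>i\<le>n. \<omega> i = x i} = emeasure (orrw_IT.CI b c ?J) {restrict x ?J}"
    using orrw_IT.lim[OF _ X] by (simp add: orrw_def)
  also have "\<dots> = emeasure (orrw_IT.C b c 0 (Suc n) (\<lambda>_. undefined)) {restrict x ?J}"
    using orrw_IT.emeasure_CI[OF order.refl X]
    by (simp add: prod_emb_id PiE_iff del: orrw_IT.C.simps)
  also have "\<dots> = (\<Prod>i<Suc n. ennreal (pmf (orrw_step b c i x) (x i)))"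
    by (rule emeasure_C_singleton)
  also have "\<dots> = ennreal (\<Prod>i<Suc n. pmf (orrw_step b c i x) (x i))"
    by (rule prod_ennreal) simp
  also have "(\<Prod>i<Suc n. pmf (orrw_step b c i x) (x i))
      = (if x 0 = [] then \<Prod>i<n. step_prob b c x i (x (Suc i)) else 0)"
    unfolding prod.lessThan_Suc_shift
    by (simp add: pmf_orrw_step_Suc[OF assms] pmf_return del: orrw_step.simps(2))
  finally show ?thesis .
qed

end

theory Submission
  imports Defs
begin

text \<open>
  Since the graph is a tree, an edge has been traversed as soon as its endpoint farther from the
  root has been visited. Hence the pair of the set \<open>V\<close> of visited vertices and
  the current position \<open>x\<close> is a Markov chain, and probabilities of events before a time \<open>n\<close> are
  given by recursions on \<open>n\<close>, linked to the trajectory measure by \<open>has_integral_weighted_exp\<close>. A vertex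
  of a new record height has an unexplored subtree above it; as long as the walk does not step down
  to the parent of that vertex, it behaves there like the walk from the root, except that at the root
  it is killed with the probability of stepping down (\<open>average_subtree\<close>).

  Let \<open>Q k n\<close> be the probability that this killed walk reaches height \<open>k\<close> within time \<open>n\<close>. Restarting
  it at the first vertex of height \<open>j\<close> gives \<open>Q j n * Q k m \<le> Q (j + k) (n + m)\<close>, so that Fekete's
  lemma yields a limit \<open>\<beta>\<close> of \<open>- ln (Q (k n) n) / n\<close> for \<open>k n = \<lceil>a n\<rceil>\<close>, \<open>a = S + \<epsilon>\<close>. It remains
  to compare the probability that \<open>h(Y\<^sub>n) \<ge> a n\<close> with \<open>Q (k n) n\<close> up to subexponential factors, and to
  see that \<open>\<beta> > 0\<close>.

  First, \<open>h(Y\<^sub>n) \<ge> k\<close> and ``height \<open>k\<close> is reached by time \<open>n\<close>'' have the same probability up to a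
  constant factor: from a record vertex the walk stays above it for ever with positive probability,
  because the root is visited only finitely often (\<open>survival_ge_p0\<close>, \<open>end_height_ge\<close>).

  Second, the killing is negligible (\<open>hit_le_killed_hit\<close>). One survives \<open>N\<close> visits to the root with
  probability at least \<open>(b / (b + c)) ^ N\<close>, so it suffices to make \<open>N\<close> small compared with \<open>n\<close>. Excursions
  from the root that discover no new vertex can be cut out of a trajectory without changing the
  probabilities of the rest; their total weight is a geometric series whose ratio is bounded away from
  1, since a walk confined to the explored region tends to climb or to leave it
  (\<open>return_supermartingale\<close>). An excursion that does discover a vertex either discovers one of the
  finitely many vertices of height at most \<open>h\<close> or takes time at least \<open>h\<close>. So there are at most
  \<open>const + n / h\<close> of them, with \<open>h\<close> arbitrarily large.

  Third, \<open>\<beta> > 0\<close>. Cut the ascent into blocks of \<open>L\<close> levels. For \<open>S < a' < a\<close> the probability \<open>\<delta>\<close> of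
  reaching height \<open>L\<close> from the root within time \<open>L / a'\<close> tends to 0 by the law of large numbers. From a
  record vertex, reaching the next \<open>L\<close> levels so fast means that the walk restricted to one of the
  subtrees rooted at the level of that vertex does so; the subtrees visited are explored
  independently, and their expected number is bounded by the inverse of the survival probability, whence
  the bound \<open>\<delta> / p0\<close>, uniformly over all histories (\<open>hit_from_record\<close>). An exponential Chebyshev
  bound over the blocks then gives exponential decay (\<open>hit_blocks\<close>).
\<close>

section \<open>Subadditive sequences\<close>

text \<open>
  Fekete's lemma: the limit is the infimum of the quotients \<open>u n / n\<close>, as a near-optimal \<open>m\<close> can be
  repeated \<open>n div m\<close> times.
\<close>

lemma subadditive_limit:
  fixes u :: "nat \<Rightarrow> real"
  assumes nonneg: "\<And>n. 0 \<le> u n" and sub: "\<And>m n. u (m + n) \<le> u m + u n"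
  obtains l where "(\<lambda>n. u n / real n) \<longlonglongrightarrow> l"
proof
  let ?A = "(\<lambda>n. u n / real n) ` {1..}"
  have bdd: "bdd_below ?A" using nonneg by (intro bdd_belowI[of _ 0]) auto
  show "(\<lambda>n. u n / real n) \<longlonglongrightarrow> Inf ?A"
  proof (rule LIMSEQ_I)
    fix e :: real assume "0 < e"
    then have "Inf ?A < Inf ?A + e / 2" by simp
    then obtain y where "y \<in> ?A" "y < Inf ?A + e / 2"
      using cInf_lessD[of ?A] by blast
    then obtain m where m: "1 \<le> m" "u m / real m < Inf ?A + e / 2" by auto
    define B where "B = (\<Sum>r<m. u r)"
    have B: "u r \<le> B" if "r < m" for r
      unfolding B_def using that nonneg by (intro member_le_sum) auto
    have mult: "u (q * m + r) \<le> real q * u m + u r" for q r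
    proof (induction q)
      case (Suc q)
      have "u (Suc q * m + r) \<le> u m + u (q * m + r)" using sub[of m "q * m + r"] by (simp add: add.assoc)
      then show ?case using Suc by (simp add: algebra_simps)
    qed simp
    have upper: "u n / real n \<le> u m / real m + B / real n" if "0 < n" for n
    proof -
      have "u n \<le> real (n div m) * u m + u (n mod m)"
        using mult[of "n div m" "n mod m"] by simp
      also have "\<dots> \<le> (real n / real m) * u m + B"
        using B[of "n mod m"] m nonneg by (intro add_mono mult_right_mono) (auto simp: of_nat_div_le_of_nat)
      finally show ?thesis using that m by (simp add: field_simps)
    qed
    obtain N where N: "2 * B / e < real N" using reals_Archimedean2 by blast
    show "\<exists>no. \<forall>n\<ge>no. norm (u n / real n - Inf ?A) < e"
    proof (intro exI[of _ "Suc N"] allI impI)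
      fix n assume n: "Suc N \<le> n"
      have "Inf ?A \<le> u n / real n" using n by (intro cInf_lower bdd) auto
      moreover have "B / real n < e / 2"
      proof -
        have "2 * B / e < real n" using N n by linarith
        then show ?thesis using n \<open>0 < e\<close> by (simp add: field_simps)
      qed
      moreover have "u n / real n \<le> u m / real m + B / real n" using n by (intro upper) simp
      ultimately show "norm (u n / real n - Inf ?A) < e"
        using m(2) unfolding real_norm_def abs_less_iff by linarith
    qed
  qed
qed

section \<open>The chain of visited sets and positions\<close>

locale orrw_chain =
  fixes b :: nat and c :: real
  assumes b_ge_2: "b \<ge> 2" and c_gt_1: "c > 1"
begin

text \<open>
  The test \<open>y = tl x\<close> gives the edge to the parent weight \<open>c\<close> whether or not the parent belongs to \<open>V\<close>.
  So the transition probabilities depend on \<open>V\<close> only through the children of \<open>x\<close>, and the comparison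
  of a subtree with the whole tree holds in arbitrary states.
\<close>

definition weight :: "vertex set \<Rightarrow> vertex \<Rightarrow> vertex \<Rightarrow> real" where
  "weight V x y = (if y = tl x \<or> y \<in> V then c else 1)"

definition total_weight :: "vertex set \<Rightarrow> vertex \<Rightarrow> real" where
  "total_weight V x = (\<Sum>y\<in>neighbours b x. weight V x y)"

definition move :: "vertex set \<Rightarrow> vertex \<Rightarrow> vertex \<Rightarrow> real" where
  "move V x y = weight V x y / total_weight V x"

text \<open>
  The expectation of \<open>f (V\<^sub>n, Y\<^sub>n)\<close> times the product of \<open>g (V\<^sub>i, Y\<^sub>i)\<close> over \<open>i < n\<close>, for the chain started
  in \<open>(V, x)\<close>.
\<close>

primrec weighted_exp :: "(vertex set \<Rightarrow> vertex \<Rightarrow> real) \<Rightarrow> (vertex set \<Rightarrow> vertex \<Rightarrow> real) \<Rightarrow> nat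
    \<Rightarrow> vertex set \<Rightarrow> vertex \<Rightarrow> real" where
  "weighted_exp g f 0 V x = f V x"
| "weighted_exp g f (Suc n) V x =
     g V x * (\<Sum>y\<in>neighbours b x. move V x y * weighted_exp g f n (insert y V) y)"

definition reach :: "nat \<Rightarrow> vertex set \<Rightarrow> bool" where
  "reach k V \<longleftrightarrow> (\<exists>v\<in>V. k \<le> length v)"

text \<open>
  The probability that height at least \<open>k\<close> is attained within \<open>n\<close> steps, where until then the walk
  survives each step from a state \<open>(V, x)\<close> with probability \<open>s V x\<close>. Once \<open>k\<close> is reached there is no
  further killing, which makes this probability monotone in \<open>n\<close>.
\<close>

primrec weighted_hit :: "(vertex set \<Rightarrow> vertex \<Rightarrow> real) \<Rightarrow> nat \<Rightarrow> nat \<Rightarrow> vertex set \<Rightarrow> vertex \<Rightarrow> real" where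
  "weighted_hit s k 0 V x = of_bool (reach k V)"
| "weighted_hit s k (Suc n) V x = (if reach k V then 1 else
     s V x * (\<Sum>y\<in>neighbours b x. move V x y * weighted_hit s k n (insert y V) y))"

text \<open>
  The probability that a walk that sits at the bottom vertex of a subtree does not step to the parent of
  that vertex, whose edge has weight \<open>c\<close>; the subtree is identified with the whole tree, so that its
  bottom vertex becomes the root.
\<close>

definition stay :: "vertex set \<Rightarrow> vertex \<Rightarrow> real" where
  "stay V x = (if x = [] then total_weight V [] / (total_weight V [] + c) else 1)"

abbreviation hit :: "nat \<Rightarrow> nat \<Rightarrow> vertex set \<Rightarrow> vertex \<Rightarrow> real" where
  "hit \<equiv> weighted_hit (\<lambda>_ _. 1)"

abbreviation killed_hit :: "nat \<Rightarrow> nat \<Rightarrow> vertex set \<Rightarrow> vertex \<Rightarrow> real" where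
  "killed_hit \<equiv> weighted_hit stay"

abbreviation survival :: "nat \<Rightarrow> vertex set \<Rightarrow> vertex \<Rightarrow> real" where
  "survival \<equiv> weighted_exp stay (\<lambda>_ _. 1)"

definition below :: "vertex set \<Rightarrow> vertex \<Rightarrow> vertex set" where
  "below V z = {u. u @ z \<in> V}"

lemma c_pos: "c > 0" using c_gt_1 by simp

lemma weight_pos: "weight V x y > 0" and weight_ge_1: "weight V x y \<ge> 1"
  using c_gt_1 by (auto simp: weight_def)

lemma total_weight_ge: "total_weight V x \<ge> b"
proof -
  have "real b \<le> real (card (neighbours b x))" by (simp add: card_neighbours)
  also have "\<dots> = (\<Sum>y\<in>neighbours b x. 1)" by simp
  also have "\<dots> \<le> total_weight V x" unfolding total_weight_def by (intro sum_mono weight_ge_1)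
  finally show ?thesis .
qed

lemma total_weight_pos: "total_weight V x > 0"
  using total_weight_ge[of V x] b_ge_2 by linarith

lemma move_nonneg: "move V x y \<ge> 0"
  using weight_pos[of V x y] total_weight_pos[of V x] by (simp add: move_def)

lemma sum_move: "(\<Sum>y\<in>neighbours b x. move V x y) = 1"
  using total_weight_pos[of V x] by (simp add: move_def sum_divide_distrib[symmetric] total_weight_def[symmetric])

lemma neighbours_sum:
  "(\<Sum>y\<in>neighbours b x. F y) = (\<Sum>i<b. F (i # x)) + (if x = [] then 0 else F (tl x))" for F :: "vertex \<Rightarrow> real"
proof -
  have nin: "tl x \<notin> (\<lambda>i. i # x) ` {..<b}"
    by (auto dest: arg_cong[where f = length])
  have "(\<Sum>y\<in>(\<lambda>i. i # x) ` {..<b}. F y) = (\<Sum>i<b. F (i # x))"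
    by (subst sum.reindex) (auto simp: inj_on_def)
  then show ?thesis using nin by (auto simp: neighbours_def)
qed

lemma average_le:
  assumes "\<And>y. y \<in> neighbours b x \<Longrightarrow> F y \<le> B"
  shows "(\<Sum>y\<in>neighbours b x. move V x y * F y) \<le> B"
proof -
  have "(\<Sum>y\<in>neighbours b x. move V x y * F y) \<le> (\<Sum>y\<in>neighbours b x. move V x y * B)"
    using assms by (intro sum_mono mult_left_mono move_nonneg)
  also have "\<dots> = B" by (simp add: sum_distrib_right[symmetric] sum_move)
  finally show ?thesis .
qed

lemma average_mono:
  assumes "\<And>y. y \<in> neighbours b x \<Longrightarrow> F y \<le> G y"
  shows "(\<Sum>y\<in>neighbours b x. move V x y * F y) \<le> (\<Sum>y\<in>neighbours b x. move V x y * G y)"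
  using assms by (intro sum_mono mult_left_mono move_nonneg)

lemma average_nonneg:
  assumes "\<And>y. y \<in> neighbours b x \<Longrightarrow> 0 \<le> F y"
  shows "0 \<le> (\<Sum>y\<in>neighbours b x. move V x y * F y)"
  using assms by (intro sum_nonneg mult_nonneg_nonneg move_nonneg)

lemma stay_pos: "0 < stay V x" and stay_le_1: "stay V x \<le> 1"
  using total_weight_pos[of V "[]"] c_pos by (auto simp: stay_def)

lemma stay_nonneg: "0 \<le> stay V x"
  using stay_pos[of V x] by simp

lemma stay_ge: "real b / (real b + c) \<le> stay V x"
proof -
  have "real b / (real b + c) = 1 - c / (real b + c)"
    "total_weight V [] / (total_weight V [] + c) = 1 - c / (total_weight V [] + c)"
    using c_pos b_ge_2 total_weight_pos[of V "[]"] by (simp_all add: divide_simps)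
  moreover have "c / (total_weight V [] + c) \<le> c / (real b + c)"
    using total_weight_ge[of V "[]"] c_pos b_ge_2 by (intro divide_left_mono) auto
  ultimately show ?thesis
    using c_pos by (simp add: stay_def)
qed

lemma stay_not_root: "x \<noteq> [] \<Longrightarrow> stay V x = 1"
  by (simp add: stay_def)

lemma reach_insert: "reach k V \<Longrightarrow> reach k (insert y V)"
  by (auto simp: reach_def)

lemma reach_mono: "reach k V \<Longrightarrow> k' \<le> k \<Longrightarrow> reach k' V"
  unfolding reach_def using le_trans by blast

lemma weighted_hit_reach: "reach k V \<Longrightarrow> weighted_hit s k n V x = 1"
  by (cases n) auto

lemma weighted_hit_nonneg:
  assumes "\<And>V x. 0 \<le> s V x"
  shows "0 \<le> weighted_hit s k n V x"
  by (induction n arbitrary: V x) (auto intro!: mult_nonneg_nonneg assms average_nonneg)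

lemma weighted_hit_le_1:
  assumes "\<And>V x. 0 \<le> s V x" "\<And>V x. s V x \<le> 1"
  shows "weighted_hit s k n V x \<le> 1"
proof (induction n arbitrary: V x)
  case (Suc n)
  then show ?case
    by (auto intro!: mult_le_one assms average_nonneg weighted_hit_nonneg average_le)
qed auto

lemma weighted_hit_mono_time_Suc:
  assumes "\<And>V x. 0 \<le> s V x"
  shows "weighted_hit s k n V x \<le> weighted_hit s k (Suc n) V x"
proof (induction n arbitrary: V x)
  case 0
  have "weighted_hit s k 0 V x = (if reach k V then 1 else 0)" by simp
  also have "\<dots> \<le> weighted_hit s k (Suc 0) V x"
    using weighted_hit_nonneg[of s k "Suc 0" V x] assms weighted_hit_reach[of k V s "Suc 0" x]
    by (auto simp del: weighted_hit.simps)
  finally show ?case .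
next
  case (Suc n)
  show ?case
  proof (cases "reach k V")
    case False
    have "s V x * (\<Sum>y\<in>neighbours b x. move V x y * weighted_hit s k n (insert y V) y)
      \<le> s V x * (\<Sum>y\<in>neighbours b x. move V x y * weighted_hit s k (Suc n) (insert y V) y)"
      by (intro mult_left_mono assms average_mono Suc)
    then show ?thesis by (subst (1 2) weighted_hit.simps(2)) (use False in auto)
  qed simp
qed

lemma weighted_hit_mono_time:
  assumes "\<And>V x. 0 \<le> s V x" "m \<le> n"
  shows "weighted_hit s k m V x \<le> weighted_hit s k n V x"
  by (rule lift_Suc_mono_le[of "\<lambda>n. weighted_hit s k n V x"])
     (use assms in \<open>auto intro: weighted_hit_mono_time_Suc simp del: weighted_hit.simps\<close>)

lemma weighted_hit_antimono_height:
  assumes "\<And>V x. 0 \<le> s V x" "\<And>V x. s V x \<le> 1" "k' \<le> k"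
  shows "weighted_hit s k n V x \<le> weighted_hit s k' n V x"
proof (induction n arbitrary: V x)
  case 0
  show ?case using reach_mono[OF _ assms(3), of V] by simp
next
  case (Suc n)
  show ?case
  proof (cases "reach k' V")
    case True
    then show ?thesis using weighted_hit_le_1[of s k "Suc n" V x] assms(1,2)
      by (simp only: weighted_hit_reach[of k' V])
  next
    case False
    then have "\<not> reach k V" using reach_mono[OF _ assms(3)] by blast
    moreover have "s V x * (\<Sum>y\<in>neighbours b x. move V x y * weighted_hit s k n (insert y V) y)
      \<le> s V x * (\<Sum>y\<in>neighbours b x. move V x y * weighted_hit s k' n (insert y V) y)"
      by (intro mult_left_mono assms(1) average_mono Suc)
    ultimately show ?thesis using False by simp
  qed
qed

lemma weighted_hit_mono_factor:
  assumes "\<And>V x. 0 \<le> s V x" "\<And>V x. s V x \<le> s' V x"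
  shows "weighted_hit s k n V x \<le> weighted_hit s' k n V x"
proof (induction n arbitrary: V x)
  case (Suc n)
  have "s V x * (\<Sum>y\<in>neighbours b x. move V x y * weighted_hit s k n (insert y V) y)
    \<le> s' V x * (\<Sum>y\<in>neighbours b x. move V x y * weighted_hit s' k n (insert y V) y)"
    using order_trans[OF assms]
    by (intro mult_mono assms average_mono average_nonneg weighted_hit_nonneg Suc) auto
  then show ?case by simp
qed simp

lemma weighted_exp_nonneg:
  assumes "\<And>V x. 0 \<le> g V x" "\<And>V x. 0 \<le> f V x"
  shows "0 \<le> weighted_exp g f n V x"
  by (induction n arbitrary: V x) (auto intro!: mult_nonneg_nonneg assms average_nonneg)

lemma weighted_exp_mono:
  assumes "\<And>V x. 0 \<le> g V x" "\<And>V x. 0 \<le> f V x" "\<And>V x. g V x \<le> g' V x" "\<And>V x. f V x \<le> f' V x"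
  shows "weighted_exp g f n V x \<le> weighted_exp g' f' n V x"
proof (induction n arbitrary: V x)
  case (Suc n)
  show ?case
    unfolding weighted_exp.simps
    using order_trans[OF assms(1,3)]
    by (intro mult_mono assms average_mono average_nonneg weighted_exp_nonneg Suc) auto
qed (simp add: assms)

lemma hit_eq_weighted_exp: "hit k n V x = weighted_exp (\<lambda>_ _. 1) (\<lambda>V _. of_bool (reach k V)) n V x"
proof (induction n arbitrary: V x)
  case (Suc n)
  show ?case
  proof (cases "reach k V")
    case True
    have "weighted_exp (\<lambda>_ _. 1) (\<lambda>V _. of_bool (reach k V)) (Suc n) V x = (\<Sum>y\<in>neighbours b x. move V x y)"
      by (simp add: Suc[symmetric] weighted_hit_reach[OF reach_insert[OF True]])
    then show ?thesis by (simp only: weighted_hit_reach[OF True] sum_move)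
  next
    case False
    then show ?thesis by (simp add: Suc)
  qed
qed simp

lemma below_insert: "below (insert (u @ z) V) z = insert u (below V z)"
  by (auto simp: below_def)

text \<open>
  One step from a vertex of the subtree above \<open>z\<close> is a step of the walk from the root in the relabelled
  explored set, unless it leaves the subtree through \<open>z\<close>. All comparisons between a subtree and the
  whole tree rest on this identity.
\<close>

lemma average_subtree:
  assumes "z \<noteq> []"
  shows "(\<Sum>y\<in>neighbours b (u @ z). move V (u @ z) y * F y) =
    stay (below V z) u * (\<Sum>w\<in>neighbours b u. move (below V z) u w * F (w @ z))
    + (1 - stay (below V z) u) * F (tl z)"
proof -
  have weight: "weight V (u @ z) (i # u @ z) = weight (below V z) u (i # u)" for i
    by (auto simp: weight_def below_def dest: arg_cong[where f = length])
  have weight': "weight V x (tl x) = c" for V x by (simp add: weight_def)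
  have sum0: "(\<Sum>y\<in>neighbours b (u @ z). weight V (u @ z) y * G y)
     = (\<Sum>i<b. weight (below V z) u (i # u) * G (i # u @ z)) + c * G (tl (u @ z))" for G
    using assms by (simp add: neighbours_sum weight weight')
  show ?thesis
  proof (cases "u = []")
    case False
    have "total_weight V (u @ z) = total_weight (below V z) u"
      using sum0[of "\<lambda>_. 1"] False by (simp add: total_weight_def neighbours_sum weight')
    moreover have "(\<Sum>y\<in>neighbours b (u @ z). weight V (u @ z) y * F y)
       = (\<Sum>w\<in>neighbours b u. weight (below V z) u w * F (w @ z))"
      unfolding sum0 using False by (simp add: neighbours_sum weight')
    ultimately show ?thesis
      using False by (simp add: move_def stay_def sum_divide_distrib[symmetric])
  next
    case True
    let ?T = "total_weight (below V z) []"
    have T: "total_weight V z = ?T + c"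
      using sum0[of "\<lambda>_. 1"] True by (simp add: total_weight_def neighbours_sum weight')
    have *: "(\<Sum>y\<in>neighbours b z. weight V z y * F y)
       = (\<Sum>w\<in>neighbours b []. weight (below V z) [] w * F (w @ z)) + c * F (tl z)"
      using sum0[of F] True by (simp add: neighbours_sum)
    have pos: "?T > 0" "?T + c > 0" using total_weight_pos[of "below V z" "[]"] c_pos by simp_all
    let ?A = "\<Sum>w\<in>neighbours b []. weight (below V z) [] w * F (w @ z)"
    have "(?A + c * F (tl z)) / (?T + c) = ?T / (?T + c) * (?A / ?T) + (1 - ?T / (?T + c)) * F (tl z)"
      using pos by (simp add: divide_simps)
    then show ?thesis
      using True by (simp add: move_def stay_def sum_divide_distrib[symmetric] T *)
  qed
qed

lemma reach_below: "reach k (below V z) \<Longrightarrow> reach (length z + k) V"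
  unfolding reach_def below_def by (auto intro!: bexI[of _ "_ @ z"])

text \<open>
  The walk may also leave the subtree above \<open>z\<close> and still reach the height, hence only an inequality.
\<close>

lemma killed_hit_subtree:
  assumes "z \<noteq> []"
  shows "killed_hit k n (below V z) u \<le> killed_hit (length z + k) n V (u @ z)"
proof (induction n arbitrary: V u)
  case 0
  show ?case using reach_below by auto
next
  case (Suc n)
  show ?case
  proof (cases "reach (length z + k) V")
    case True
    then show ?thesis using weighted_hit_le_1[OF stay_nonneg stay_le_1, where k = k and n = "Suc n" and V = "below V z" and x = u]
      by (simp only: weighted_hit_reach[of "length z + k" V])
  next
    case False
    let ?B = "below V z"
    have "stay ?B u * (\<Sum>w\<in>neighbours b u. move ?B u w * killed_hit k n (insert w ?B) w)
       \<le> stay ?B u * (\<Sum>w\<in>neighbours b u. move ?B u w * killed_hit (length z + k) n (insert (w @ z) V) (w @ z))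
       + (1 - stay ?B u) * killed_hit (length z + k) n (insert (tl z) V) (tl z)"
      using stay_le_1[of ?B u] Suc
      by (intro add_increasing2 mult_nonneg_nonneg weighted_hit_nonneg stay_nonneg mult_left_mono average_mono)
         (simp_all add: below_insert[symmetric])
    also have "\<dots> = (\<Sum>y\<in>neighbours b (u @ z). move V (u @ z) y * killed_hit (length z + k) n (insert y V) y)"
      by (rule average_subtree[OF assms, of V u "\<lambda>y. killed_hit (length z + k) n (insert y V) y", symmetric])
    finally show ?thesis using False reach_below by (auto simp: stay_not_root assms)
  qed
qed

lemma survival_subtree:
  assumes "z \<noteq> []"
  shows "survival n (below V z) u \<le> weighted_exp (\<lambda>_ _. 1) (\<lambda>_ x. of_bool (length z \<le> length x)) n V (u @ z)"
proof -
  define f where "f = (\<lambda>(_::vertex set) (x::vertex). of_bool (length z \<le> length x) :: real)"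
  have f: "0 \<le> weighted_exp (\<lambda>_ _. 1) f n V x" for n V x
    by (rule weighted_exp_nonneg) (simp_all add: f_def)
  have "survival n (below V z) u \<le> weighted_exp (\<lambda>_ _. 1) f n V (u @ z)"
  proof (induction n arbitrary: V u)
    case 0
    show ?case by (simp add: f_def)
  next
    case (Suc n)
    let ?B = "below V z" and ?F = "\<lambda>y. weighted_exp (\<lambda>_ _. 1) f n (insert y V) y"
    have "survival n (insert w ?B) w \<le> ?F (w @ z)" for w
      using Suc[of "insert (w @ z) V" w] by (simp only: below_insert)
    then have "stay ?B u * (\<Sum>w\<in>neighbours b u. move ?B u w * survival n (insert w ?B) w)
      \<le> stay ?B u * (\<Sum>w\<in>neighbours b u. move ?B u w * ?F (w @ z))"
      by (intro mult_left_mono average_mono stay_nonneg)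
    also have "\<dots> \<le> \<dots> + (1 - stay ?B u) * ?F (tl z)"
      using stay_le_1[of ?B u] f by simp
    also have "\<dots> = (\<Sum>y\<in>neighbours b (u @ z). move V (u @ z) y * ?F y)"
      by (rule average_subtree[OF assms, of V u ?F, symmetric])
    finally show ?case by simp
  qed
  then show ?thesis by (simp add: f_def)
qed

lemma below_new_record:
  assumes "\<not> reach (length y) V"
  shows "below (insert y V) y = {[]}"
  using assms by (auto simp: below_def reach_def)

section \<open>Supermultiplicativity\<close>

definition Q :: "nat \<Rightarrow> nat \<Rightarrow> real" where
  "Q k n = killed_hit k n {[]} []"

lemma Q_nonneg: "0 \<le> Q k n" and Q_le_1: "Q k n \<le> 1"
  unfolding Q_def by (intro weighted_hit_nonneg weighted_hit_le_1 stay_nonneg stay_le_1)+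

lemma Q_mono: "k' \<le> k \<Longrightarrow> n \<le> n' \<Longrightarrow> Q k n \<le> Q k' n'"
  unfolding Q_def
  by (rule order_trans[OF weighted_hit_mono_time[of stay n n'] weighted_hit_antimono_height[of stay k' k]])
     (simp_all add: stay_nonneg stay_le_1)

lemma neighbour_length: "y \<in> neighbours b x \<Longrightarrow> length y \<le> Suc (length x)"
  by (auto simp: neighbours_def split: if_splits)

lemma reach_insert_step:
  assumes "\<not> reach k V" "x \<in> V" "y \<in> neighbours b x" "reach k (insert y V)"
  shows "length y = k"
proof -
  have "length x < k" using assms by (auto simp: reach_def not_le)
  moreover have "k \<le> length y" using assms by (auto simp: reach_def)
  ultimately show ?thesis using neighbour_length[OF assms(3)] by simp
qed

text \<open>
  When the walk first reaches height \<open>j\<close>, the subtree above its position is unexplored, and staying in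
  that subtree keeps it away from the root; so what follows costs no more than \<open>Q k m\<close>.
\<close>

lemma killed_hit_restart:
  assumes "0 < j" "\<not> reach j V" "x \<in> V"
  shows "killed_hit j n V x * Q k m \<le> killed_hit (j + k) (n + m) V x"
  using assms(2,3)
proof (induction n arbitrary: V x)
  case 0
  then show ?case by (simp add: weighted_hit_nonneg stay_nonneg)
next
  case (Suc n)
  have nr: "\<not> reach (j + k) V" using Suc.prems reach_mono le_add1 by blast
  have *: "killed_hit j n (insert y V) y * Q k m \<le> killed_hit (j + k) (n + m) (insert y V) y"
    if y: "y \<in> neighbours b x" for y
  proof (cases "reach j (insert y V)")
    case True
    then have y_len: "length y = j" using reach_insert_step Suc.prems y by blast
    then have "y \<noteq> []" using assms(1) by auto
    have "killed_hit j n (insert y V) y * Q k m = Q k m" using True by (simp add: weighted_hit_reach)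
    also have "\<dots> \<le> Q k (n + m)" by (intro Q_mono) auto
    also have "\<dots> = killed_hit k (n + m) (below (insert y V) y) []"
      using below_new_record[of y V] Suc.prems y_len by (simp add: Q_def)
    also have "\<dots> \<le> killed_hit (j + k) (n + m) (insert y V) y"
      using killed_hit_subtree[OF \<open>y \<noteq> []\<close>, of k "n + m" "insert y V" "[]"] y_len by simp
    finally show ?thesis .
  qed (use Suc.IH[of "insert y V" y] in auto)
  have "killed_hit j (Suc n) V x * Q k m
     = stay V x * (\<Sum>y\<in>neighbours b x. move V x y * (killed_hit j n (insert y V) y * Q k m))"
    using Suc.prems by (simp add: sum_distrib_left sum_distrib_right mult_ac)
  also have "\<dots> \<le> stay V x * (\<Sum>y\<in>neighbours b x. move V x y * killed_hit (j + k) (n + m) (insert y V) y)"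
    by (intro mult_left_mono average_mono * stay_nonneg)
  finally show ?case using nr by simp
qed

lemma Q_supermult: "Q j n * Q k m \<le> Q (j + k) (n + m)"
proof (cases "j = 0")
  case True
  have "Q j n * Q k m \<le> 1 * Q k m" by (intro mult_right_mono Q_le_1 Q_nonneg)
  also have "\<dots> \<le> Q k (n + m)" by (simp add: Q_mono)
  finally show ?thesis using True by simp
next
  case False
  then show ?thesis
    using killed_hit_restart[of j "{[]}" "[]" n k m] by (simp add: Q_def reach_def)
qed

text \<open>One step up has positive probability, and such steps can be concatenated by supermultiplicativity.\<close>

lemma Q_pos:
  assumes "k \<le> n"
  shows "0 < Q k n"
proof -
  have "Q 1 1 = stay {[]} []"
  proof -
    have "reach (Suc 0) {y, []}" if "y \<in> neighbours b []" for y
      using that by (auto simp: reach_def neighbours_def)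
    then show ?thesis
      by (simp add: Q_def reach_def[of _ "{[]}"] sum_move)
  qed
  then have 1: "0 < Q 1 1" using stay_pos by simp
  have "0 < Q k k"
  proof (induction k)
    case 0
    show ?case by (simp add: Q_def reach_def)
  next
    case (Suc k)
    have "0 < Q k k * Q 1 1" using Suc 1 by simp
    also have "\<dots> \<le> Q (Suc k) (Suc k)" using Q_supermult[of k k 1 1] by simp
    finally show ?case .
  qed
  also have "\<dots> \<le> Q k n" using assms by (intro Q_mono) auto
  finally show ?thesis .
qed

section \<open>Killing at the root costs a subexponential factor\<close>

definition return_ratio :: real where "return_ratio = c / (c + 1)"

lemma return_ratio: "0 < return_ratio" "return_ratio < 1" "1 / (1 - return_ratio) = c + 1" "1/2 \<le> return_ratio"
  using c_gt_1 by (auto simp: return_ratio_def field_simps)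

text \<open>
  Along a walk that stops when it discovers a vertex, \<open>return_ratio ^ height\<close> is a supermartingale:
  every unexplored child contributes a chance to stop, and if all the \<open>b \<ge> 2\<close> children are explored, the
  walk drifts upwards. With the value \<open>c / (c + 1)\<close>, the downward step contributes \<open>c + 1\<close> instead
  of its weight \<open>c\<close>, and each of the at least two children makes up for 1/2 of this excess.
  Consequently the walk returns from \<open>y\<close> to the root without a discovery with probability at most \<open>return_ratio ^ length y\<close>.
\<close>

lemma return_supermartingale:
  assumes "y \<noteq> []"
  shows "(\<Sum>w\<in>neighbours b y. move V y w * (if w = tl y \<or> w \<in> V then return_ratio ^ length w else 0)) \<le> return_ratio ^ length y"
proof -
  let ?l = "return_ratio ^ length y"
  define e where "e i = (i # y \<in> V)" for i
  have child: "i # y \<noteq> tl y" for i by (auto dest: arg_cong[where f = length])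
  have l: "return_ratio ^ length (tl y) = ?l / return_ratio"
    using assms return_ratio(1) by (cases y) auto
  have total_weight: "total_weight V y = (\<Sum>i<b. if e i then c else 1) + c"
    using assms child by (simp add: total_weight_def neighbours_sum weight_def e_def)
  have "(\<Sum>w\<in>neighbours b y. weight V y w * (if w = tl y \<or> w \<in> V then return_ratio ^ length w else 0))
     = (\<Sum>i<b. if e i then c * return_ratio * ?l else 0) + c * (?l / return_ratio)"
  proof -
    have "(\<Sum>i<b. weight V y (i # y) * (if i # y = tl y \<or> i # y \<in> V then return_ratio ^ length (i # y) else 0))
       = (\<Sum>i<b. if e i then c * return_ratio * ?l else 0)"
      using child by (intro sum.cong) (auto simp: weight_def e_def)
    then show ?thesis
      unfolding neighbours_sum using assms by (simp add: l[symmetric] weight_def del: length_tl)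
  qed
  also have "\<dots> = ((\<Sum>i<b. if e i then c * return_ratio else 0) + (c + 1)) * ?l"
  proof -
    have "c / return_ratio = c + 1" using c_pos by (simp add: return_ratio_def)
    then have "c * (?l / return_ratio) = (c + 1) * ?l" by (metis times_divide_eq_left times_divide_eq_right)
    moreover have "(\<Sum>i<b. if e i then c * return_ratio * ?l else 0) = (\<Sum>i<b. if e i then c * return_ratio else 0) * ?l"
      by (auto simp: sum_distrib_right intro!: sum.cong)
    ultimately show ?thesis by (simp add: distrib_right)
  qed
  also have "\<dots> \<le> total_weight V y * ?l"
  proof (intro mult_right_mono)
    have "1 \<le> real b * (1/2)" using b_ge_2 by simp
    also have "\<dots> = (\<Sum>i<b. 1/2)" by simp
    also have "\<dots> \<le> (\<Sum>i<b. (if e i then c else 1) - (if e i then c * return_ratio else 0))"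
    proof (intro sum_mono)
      have "c - c * return_ratio = return_ratio" using c_pos by (simp add: return_ratio_def field_simps)
      then show "1/2 \<le> (if e i then c else 1) - (if e i then c * return_ratio else 0)" for i
        using return_ratio(4) by auto
    qed
    finally show "(\<Sum>i<b. if e i then c * return_ratio else 0) + (c + 1) \<le> total_weight V y"
      by (simp add: total_weight sum_subtractf)
  qed (use return_ratio in simp)
  finally show ?thesis
    using total_weight_pos[of V y] by (simp add: move_def sum_divide_distrib[symmetric] divide_le_eq mult.commute)
qed

definition Tree :: "nat \<Rightarrow> vertex set" where
  "Tree h = {v. set v \<subseteq> {..<b} \<and> length v \<le> h}"

lemma finite_Tree: "finite (Tree h)"
  unfolding Tree_def by (rule finite_lists_length_le) simp

text \<open>
  An upper bound for the number of excursions from the root within time \<open>n\<close> that discover a vertex, if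
  \<open>V\<close> has been visited before: each discovers a vertex of height at most \<open>h\<close>, or lasts longer than \<open>h\<close>.
\<close>

definition budget :: "nat \<Rightarrow> vertex set \<Rightarrow> nat \<Rightarrow> nat" where
  "budget h V n = card (Tree h - V) + n div h"

text \<open>
  The factor lost per excursion with a discovery: \<open>c + 1\<close> is the sum of the geometric series for the
  excursions without discovery that precede it, and \<open>(b + c) / b\<close> bounds the inverse of the probability
  of not being killed at the root.
\<close>

definition loop_cost :: real where "loop_cost = (c + 1) * ((real b + c) / real b)"

lemma loop_cost_ge_1: "loop_cost \<ge> 1"
proof -
  have "1 \<le> (real b + c) / real b" using b_ge_2 c_pos by (simp add: field_simps)
  then have "1 * 1 \<le> loop_cost" unfolding loop_cost_def using c_pos by (intro mult_mono) auto
  then show ?thesis by simp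
qed

lemma budget_mono: "V \<subseteq> V' \<Longrightarrow> n' \<le> n \<Longrightarrow> budget h V' n' \<le> budget h V n"
  unfolding budget_def by (intro add_mono card_mono div_le_mono) (auto simp: finite_Tree)

text \<open>
  The new budget is taken at time \<open>m - length w\<close>, since the walk needs \<open>length w\<close> steps from \<open>w\<close> to be
  back at the root; this is where a discovery above height \<open>h\<close> uses up time at least \<open>h\<close>.
\<close>

lemma budget_explore:
  assumes "w \<notin> V" "set w \<subseteq> {..<b}" "m + length w \<le> n" "0 < h"
  shows "Suc (budget h (insert w V) (m - length w)) \<le> budget h V n"
proof (cases "length w \<le> h")
  case True
  then have w: "w \<in> Tree h - V" using assms by (auto simp: Tree_def)
  have "Tree h - insert w V = (Tree h - V) - {w}" by auto
  then have "Suc (card (Tree h - insert w V)) = card (Tree h - V)"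
    using card.remove[OF _ w] finite_Tree by simp
  moreover have "(m - length w) div h \<le> n div h" using assms by (intro div_le_mono) simp
  ultimately show ?thesis by (simp add: budget_def)
next
  case False
  have "Suc ((m - length w) div h) \<le> (m + h) div h"
    using \<open>0 < h\<close> by (simp add: div_le_mono)
  also have "\<dots> \<le> n div h" using False assms by (intro div_le_mono) simp
  moreover have "card (Tree h - insert w V) \<le> card (Tree h - V)"
    by (intro card_mono) (auto simp: finite_Tree)
  ultimately show ?thesis by (simp add: budget_def)
qed

lemma neighbour_letters: "y \<in> neighbours b x \<Longrightarrow> set x \<subseteq> {..<b} \<Longrightarrow> set y \<subseteq> {..<b}"
  by (cases x) (auto simp: neighbours_def split: if_splits)

lemma hit_nonneg: "0 \<le> hit k n V x" and killed_hit_nonneg: "0 \<le> killed_hit k n V x"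
  by (simp_all add: weighted_hit_nonneg stay_nonneg)

text \<open>
  From \<open>y\<close>, the walk reaches the height before it returns to the root, or discovers a vertex, after
  which the induction hypothesis applies with a smaller budget, or returns to the root without a
  discovery. The last case leads to the state \<open>(V, [])\<close> again, with less time than \<open>n\<close>, and has
  probability at most \<open>return_ratio ^ length y\<close>.
\<close>

lemma hit_le_loops:
  assumes h: "0 < h" and n: "m + length y \<le> n" "m < n" and y: "y \<noteq> []" "set y \<subseteq> {..<b}"
    and nr: "\<not> reach k V"
    and IH: "\<And>m V x. m < n \<Longrightarrow> set x \<subseteq> {..<b} \<Longrightarrow> [] \<in> V \<Longrightarrow>
        hit k m V x \<le> loop_cost ^ Suc (budget h V (m - length x)) * killed_hit k m V x"
    and nil: "[] \<in> V"
  shows "hit k m V y \<le> loop_cost ^ budget h V n * killed_hit k m V y + return_ratio ^ length y * hit k n V []"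
  using n y
proof (induction m arbitrary: y)
  case 0
  show ?case using nr loop_cost_ge_1 hit_nonneg[of k n V "[]"] return_ratio by simp
next
  case (Suc m)
  let ?E = "loop_cost ^ budget h V n" and ?U = "hit k n V []"
  let ?l = "\<lambda>w. if w = tl y \<or> w \<in> V then return_ratio ^ length w else 0"
  have step: "hit k m (insert w V) w \<le> ?E * killed_hit k m (insert w V) w + ?l w * ?U"
    if w: "w \<in> neighbours b y" for w
  proof (cases "w \<in> V")
    case True
    then have ins: "insert w V = V" by auto
    show ?thesis
    proof (cases "w = []")
      case True
      have "hit k m V [] \<le> ?U" using Suc.prems by (intro weighted_hit_mono_time) auto
      moreover have "0 \<le> ?E * killed_hit k m V []" using loop_cost_ge_1 by (simp add: killed_hit_nonneg)
      ultimately show ?thesis using True nil ins by simp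
    next
      case False
      have "m + length w \<le> n" using neighbour_length[OF w] Suc.prems by simp
      then show ?thesis using Suc.IH[of w] False Suc.prems neighbour_letters[OF w] True ins by simp
    qed
  next
    case False
    have "hit k m (insert w V) w \<le> loop_cost ^ Suc (budget h (insert w V) (m - length w)) * killed_hit k m (insert w V) w"
      using Suc.prems neighbour_letters[OF w] nil by (intro IH) auto
    also have "\<dots> \<le> ?E * killed_hit k m (insert w V) w"
      using False Suc.prems neighbour_letters[OF w] neighbour_length[OF w] h loop_cost_ge_1
      by (intro mult_right_mono power_increasing budget_explore killed_hit_nonneg) auto
    also have "\<dots> \<le> \<dots> + ?l w * ?U"
      using hit_nonneg[of k n V "[]"] return_ratio by auto
    finally show ?thesis .
  qed
  have "hit k (Suc m) V y = (\<Sum>w\<in>neighbours b y. move V y w * hit k m (insert w V) w)"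
    using nr by simp
  also have "\<dots> \<le> (\<Sum>w\<in>neighbours b y. move V y w * (?E * killed_hit k m (insert w V) w + ?l w * ?U))"
    by (intro average_mono step)
  also have "\<dots> = ?E * (\<Sum>w\<in>neighbours b y. move V y w * killed_hit k m (insert w V) w)
      + (\<Sum>w\<in>neighbours b y. move V y w * ?l w) * ?U"
    by (simp only: distrib_left sum.distrib sum_distrib_left sum_distrib_right mult_ac)
  also have "\<dots> \<le> ?E * (\<Sum>w\<in>neighbours b y. move V y w * killed_hit k m (insert w V) w) + return_ratio ^ length y * ?U"
    using return_supermartingale[OF Suc.prems(3), of V] hit_nonneg by (intro add_left_mono mult_right_mono)
  finally show ?case using nr Suc.prems by (simp add: stay_not_root)
qed

text \<open>
  In the crucial case \<open>x = []\<close>, the preceding lemma bounds \<open>hit k n V []\<close> by a multiple of the killed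
  probability plus \<open>return_ratio\<close> times \<open>hit k n V []\<close> itself. The last term is absorbed in the
  left-hand side, which sums the geometric series over the excursions without discovery.
\<close>

lemma hit_le_killed_hit:
  assumes h: "0 < h" and "set x \<subseteq> {..<b}" "[] \<in> V"
  shows "hit k n V x \<le> loop_cost ^ Suc (budget h V (n - length x)) * killed_hit k n V x"
  using assms(2,3)
proof (induction n arbitrary: V x rule: less_induct)
  case (less n)
  let ?loop_cost = "loop_cost ^ Suc (budget h V (n - length x))"
  have D1: "1 \<le> ?loop_cost" using loop_cost_ge_1 by (rule one_le_power)
  show ?case
  proof (cases "n = 0 \<or> reach k V")
    case True
    then have "hit k n V x = killed_hit k n V x" by (auto simp: weighted_hit_reach)
    then show ?thesis using mult_right_mono[OF D1 killed_hit_nonneg[of k n V x]] by simp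
  next
    case False
    then obtain m where m: "n = Suc m" and nr: "\<not> reach k V" by (cases n) auto
    show ?thesis
    proof (cases "x = []")
      case x: False
      have "hit k m (insert y V) y \<le> ?loop_cost * killed_hit k m (insert y V) y" if y: "y \<in> neighbours b x" for y
      proof -
        have "length x \<le> Suc (length y)" using y by (auto simp: neighbours_def split: if_splits)
        then have "m - length y \<le> n - length x" using m by simp
        then have "loop_cost ^ Suc (budget h (insert y V) (m - length y)) \<le> ?loop_cost"
          using budget_mono[of V "insert y V"] loop_cost_ge_1 by (auto intro!: power_increasing simp del: power_Suc)
        then have "loop_cost ^ Suc (budget h (insert y V) (m - length y)) * killed_hit k m (insert y V) y
            \<le> ?loop_cost * killed_hit k m (insert y V) y"
          by (rule mult_right_mono) (rule killed_hit_nonneg)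
        moreover have "hit k m (insert y V) y
            \<le> loop_cost ^ Suc (budget h (insert y V) (m - length y)) * killed_hit k m (insert y V) y"
          using less.prems m neighbour_letters[OF y] by (intro less.IH) auto
        ultimately show ?thesis by linarith
      qed
      then have "(\<Sum>y\<in>neighbours b x. move V x y * hit k m (insert y V) y)
        \<le> (\<Sum>y\<in>neighbours b x. move V x y * (?loop_cost * killed_hit k m (insert y V) y))"
        by (rule average_mono)
      also have "\<dots> = ?loop_cost * (\<Sum>y\<in>neighbours b x. move V x y * killed_hit k m (insert y V) y)"
        by (simp only: sum_distrib_left mult_ac)
      finally show ?thesis using x m nr by (simp add: stay_not_root)
    next
      case x: True
      let ?E = "loop_cost ^ budget h V n" and ?U = "hit k n V []"
      have step: "hit k m (insert w V) w \<le> ?E * killed_hit k m (insert w V) w + return_ratio * ?U"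
        if w: "w \<in> neighbours b x" for w
      proof -
        have w1: "length w = 1" "w \<noteq> []" and letters: "set w \<subseteq> {..<b}"
          using w x neighbour_letters[OF w] by (auto simp: neighbours_def)
        show ?thesis
        proof (cases "w \<in> V")
          case True
          then have ins: "insert w V = V" by auto
          have "hit k m V w \<le> ?E * killed_hit k m V w + return_ratio ^ length w * ?U"
            using m w1 letters nr h less.prems less.IH by (intro hit_le_loops) auto
          then show ?thesis using w1 ins by simp
        next
          case False
          have "hit k m (insert w V) w
              \<le> loop_cost ^ Suc (budget h (insert w V) (m - length w)) * killed_hit k m (insert w V) w"
            using m letters less.prems by (intro less.IH) auto
          also have "\<dots> \<le> ?E * killed_hit k m (insert w V) w"
            using False w1 letters h loop_cost_ge_1 m
            by (intro mult_right_mono power_increasing budget_explore killed_hit_nonneg) auto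
          also have "\<dots> \<le> \<dots> + return_ratio * ?U" using hit_nonneg[of k n V "[]"] return_ratio by simp
          finally show ?thesis .
        qed
      qed
      let ?S = "\<Sum>w\<in>neighbours b x. move V x w * killed_hit k m (insert w V) w"
      have "?U = (\<Sum>w\<in>neighbours b x. move V x w * hit k m (insert w V) w)"
        using nr m x by simp
      also have "\<dots> \<le> (\<Sum>w\<in>neighbours b x. move V x w * (?E * killed_hit k m (insert w V) w + return_ratio * ?U))"
        by (intro average_mono step)
      also have "\<dots> = ?E * ?S + (\<Sum>w\<in>neighbours b x. move V x w) * (return_ratio * ?U)"
        by (simp only: distrib_left sum.distrib sum_distrib_left sum_distrib_right mult_ac)
      finally have "(1 - return_ratio) * ?U \<le> ?E * ?S" by (simp add: sum_move algebra_simps)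
      then have "?U \<le> (1 / (1 - return_ratio)) * (?E * ?S)"
        using return_ratio(2) by (simp add: field_simps)
      also have "\<dots> = (c + 1) * ?E * ?S" by (simp add: return_ratio(3))
      also have "?S \<le> (real b + c) / real b * killed_hit k n V []"
      proof -
        have S0: "0 \<le> ?S" by (intro average_nonneg killed_hit_nonneg)
        have "killed_hit k n V [] = stay V [] * ?S" using nr m x by simp
        moreover have "real b / (real b + c) * ?S \<le> stay V [] * ?S"
          by (intro mult_right_mono stay_ge S0)
        ultimately have "real b / (real b + c) * ?S \<le> killed_hit k n V []" by simp
        then show ?thesis using b_ge_2 c_pos by (simp add: field_simps)
      qed
      finally have "?U \<le> (c + 1) * ?E * ((real b + c) / real b * killed_hit k n V [])"
        using loop_cost_ge_1 c_pos by simp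
      also have "\<dots> = loop_cost ^ Suc (budget h V n) * killed_hit k n V []" by (simp add: loop_cost_def mult_ac)
      finally show ?thesis using x by simp
    qed
  qed
qed

section \<open>Staying high after a record\<close>

lemma hit_le_1: "hit k n V x \<le> 1"
  by (simp add: weighted_hit_le_1)

lemma hit_mono_time: "m \<le> n \<Longrightarrow> hit k m V x \<le> hit k n V x"
  by (simp add: weighted_hit_mono_time)

lemma survival_nonneg: "0 \<le> survival n V x"
  by (simp add: weighted_exp_nonneg stay_nonneg)

lemma survival_le_1: "survival n V x \<le> 1"
proof (induction n arbitrary: V x)
  case (Suc n)
  show ?case unfolding weighted_exp.simps
    by (intro mult_le_one stay_le_1 average_nonneg average_le Suc survival_nonneg)
qed simp

text \<open>
  Once height \<open>k\<close> is reached, it suffices not to leave the subtree above the vertex reached; \<open>p0\<close> bounds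
  the probability of this from below.
\<close>

lemma end_height_ge:
  assumes "0 < k" "\<not> reach k V" "x \<in> V" and p0: "\<And>n. p0 \<le> survival n {[]} []"
  shows "p0 * hit k n V x \<le> weighted_exp (\<lambda>_ _. 1) (\<lambda>_ x. of_bool (k \<le> length x)) n V x"
  using assms(2,3)
proof (induction n arbitrary: V x)
  case 0
  then show ?case by simp
next
  case (Suc n)
  let ?f = "weighted_exp (\<lambda>_ _. 1) (\<lambda>_ x. of_bool (k \<le> length x)) n"
  have step: "p0 * hit k n (insert y V) y \<le> ?f (insert y V) y" if y: "y \<in> neighbours b x" for y
  proof (cases "reach k (insert y V)")
    case True
    then have len: "length y = k" using reach_insert_step Suc.prems y by blast
    then have "y \<noteq> []" using \<open>0 < k\<close> by auto
    have "p0 * hit k n (insert y V) y \<le> survival n (below (insert y V) y) []"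
      using True p0 below_new_record[of y V] Suc.prems len by (simp add: weighted_hit_reach)
    also have "\<dots> \<le> ?f (insert y V) y"
      using survival_subtree[OF \<open>y \<noteq> []\<close>, of n "insert y V" "[]"] len by simp
    finally show ?thesis .
  qed (use Suc.IH in auto)
  have "p0 * hit k (Suc n) V x = (\<Sum>y\<in>neighbours b x. move V x y * (p0 * hit k n (insert y V) y))"
    using Suc.prems by (simp add: sum_distrib_left mult_ac)
  also have "\<dots> \<le> (\<Sum>y\<in>neighbours b x. move V x y * ?f (insert y V) y)"
    by (intro average_mono step)
  finally show ?case by simp
qed

section \<open>Fast ascents from a record\<close>

text \<open>
  Closure under \<open>tl\<close> says that all ancestors of visited vertices have been visited. It guarantees that
  the subtree above a vertex outside \<open>V\<close> is unexplored.
\<close>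

definition walk_state :: "vertex set \<Rightarrow> vertex \<Rightarrow> bool" where
  "walk_state V x \<longleftrightarrow> finite V \<and> x \<in> V \<and> (\<forall>v\<in>V. v \<noteq> [] \<longrightarrow> tl v \<in> V)"

lemma walk_state_suffix: "walk_state V x \<Longrightarrow> u @ z \<in> V \<Longrightarrow> z \<in> V"
proof (induction u)
  case (Cons i u)
  then have "tl (i # u @ z) \<in> V" unfolding walk_state_def by (metis append_Cons list.distinct(1))
  then show ?case using Cons by simp
qed simp

lemma walk_state_step:
  assumes "walk_state V x" "y \<in> neighbours b x"
  shows "walk_state (insert y V) y"
  using assms by (auto simp: walk_state_def neighbours_def split: if_splits)

text \<open>
  The position within the subtree above \<open>z\<close>. It is the bottom vertex \<open>[]\<close> if \<open>x\<close> lies outside, because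
  a walk that has left the subtree has to come back through \<open>z\<close>.
\<close>

definition pos :: "vertex \<Rightarrow> vertex \<Rightarrow> vertex" where
  "pos z x = (if \<exists>u. x = u @ z then THE u. x = u @ z else [])"

lemma pos_append [simp]: "pos z (u @ z) = u"
  by (auto simp: pos_def)

lemma pos_self [simp]: "pos z z = []"
  using pos_append[of z "[]"] by simp

lemma pos_other: "(\<And>u. x \<noteq> u @ z) \<Longrightarrow> pos z x = []"
  by (auto simp: pos_def)

lemma pos_short: "length x \<le> length z \<Longrightarrow> pos z x = []"
  by (cases "x = z") (auto intro!: pos_other)

lemma split_at_level:
  assumes "j \<le> length x"
  obtains u z where "x = u @ z" "length z = j"
  using assms that[of "take (length x - j) x" "drop (length x - j) x"] by simp

definition level :: "nat \<Rightarrow> vertex set \<Rightarrow> vertex set" where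
  "level j V = {z \<in> V. length z = j}"

text \<open>
  Watched only inside the subtree above \<open>z\<close>, with the steps down from \<open>z\<close> deleted, the walk is a
  once-reinforced walk from the root. This is the sum, over the visited vertices \<open>z\<close> of height \<open>j\<close>, of
  the probabilities that these watched walks climb \<open>L\<close> levels within time \<open>m\<close>: a union bound.
\<close>

definition local_hits :: "nat \<Rightarrow> nat \<Rightarrow> nat \<Rightarrow> vertex set \<Rightarrow> vertex \<Rightarrow> real" where
  "local_hits j L m V x = (\<Sum>z\<in>level j V. hit L m (below V z) (pos z x))"

text \<open>
  The probability of not leaving for \<open>m\<close> steps the subtree of height \<open>j\<close> that contains \<open>x\<close>; it is 0 if
  \<open>x\<close> is below height \<open>j\<close>, where there is no such subtree.
\<close>

definition local_survival :: "nat \<Rightarrow> nat \<Rightarrow> vertex set \<Rightarrow> vertex \<Rightarrow> real" where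
  "local_survival j m V x = (if j \<le> length x then
     survival m (below V (drop (length x - j) x)) (take (length x - j) x) else 0)"

lemma local_survival_append: "length z = j \<Longrightarrow> local_survival j m V (u @ z) = survival m (below V z) u"
  by (simp add: local_survival_def)

lemma local_survival_bounds: "0 \<le> local_survival j m V x" "local_survival j m V x \<le> 1"
  by (auto simp: local_survival_def survival_nonneg survival_le_1)

lemma local_hits_nonneg: "0 \<le> local_hits j L m V x"
  unfolding local_hits_def by (intro sum_nonneg hit_nonneg)

lemma below_insert_other:
  "length z = length z' \<Longrightarrow> z \<noteq> z' \<Longrightarrow> below (insert (u @ z) V) z' = below V z'"
  by (auto simp: below_def)

lemma below_insert_short: "length y < length z \<Longrightarrow> below (insert y V) z = below V z"
  by (auto simp: below_def)

lemma finite_level: "walk_state V x \<Longrightarrow> finite (level j V)"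
  by (simp add: level_def walk_state_def)

lemma one_le_local_hits:
  assumes "walk_state V x" "reach (j + L) V"
  shows "1 \<le> local_hits j L m V x"
proof -
  obtain v where v: "v \<in> V" "j + L \<le> length v" using assms by (auto simp: reach_def)
  obtain u z where uz: "v = u @ z" "length z = j" using split_at_level[of j v] v by auto
  have z: "z \<in> level j V" using walk_state_suffix assms v uz by (auto simp: level_def)
  have "reach L (below V z)" using v uz by (auto simp: reach_def below_def intro!: bexI[of _ u])
  then have "1 = hit L m (below V z) (pos z x)" by (simp add: weighted_hit_reach)
  also have "\<dots> \<le> local_hits j L m V x"
    unfolding local_hits_def using finite_level[OF assms(1)] z by (intro member_le_sum hit_nonneg)
  finally show ?thesis .
qed

lemma local_hits_inside:
  assumes "walk_state V (u @ z)" "length z = j"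
  shows "local_hits j L m (insert (w @ z) V) (w @ z) =
    hit L m (insert w (below V z)) w + (\<Sum>z'\<in>level j V - {z}. hit L m (below V z') [])"
proof -
  have z: "z \<in> level j V" using walk_state_suffix[OF assms(1)] assms by (auto simp: level_def walk_state_def)
  then have lev: "level j (insert (w @ z) V) = level j V"
    using assms(2) by (auto simp: level_def)
  have "pos z' (w @ z) = []" if "z' \<in> level j V - {z}" for z'
    using that assms(2) by (auto intro!: pos_other simp: level_def)
  moreover have "below (insert (w @ z) V) z' = below V z'" if "z' \<in> level j V - {z}" for z'
    using that assms(2) by (intro below_insert_other) (auto simp: level_def)
  ultimately show ?thesis
    unfolding local_hits_def lev
    by (subst sum.remove[OF finite_level[OF assms(1)] z]) (simp add: below_insert)
qed

text \<open>
  The right-hand side is a supermartingale that dominates the indicator of reaching height \<open>j + L\<close>. Its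
  second term pays for the subtrees of level \<open>j\<close> that are still to be entered. As each entry is the
  last one with probability at least \<open>p0\<close>, their expected number is at most \<open>(1 - s) / p0\<close>, with \<open>s\<close>
  the probability of not leaving the current subtree, and each of them adds at most
  \<open>hit L T {[]} []\<close> to the sum. On entering a new one, this increase is matched by the decrease of
  \<open>1 - s\<close> from 1 to at most \<open>1 - p0\<close>.
\<close>

lemma hit_le_local_hits:
  fixes j L m T :: nat and p0 :: real
  assumes p0: "0 < p0" "\<And>n. p0 \<le> survival n {[]} []" and "0 < j"
    and "walk_state V x" "m \<le> T"
  defines "K \<equiv> hit L T {[]} [] / p0"
  shows "hit (j + L) m V x \<le> local_hits j L m V x + K * (1 - local_survival j m V x)"
  using assms(4,5)
proof (induction m arbitrary: V x)
  case 0
  have K: "0 \<le> K" using p0(1) hit_nonneg by (simp add: K_def)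
  show ?case
    using K local_survival_bounds[of j 0 V x] local_hits_nonneg[of j L 0 V x] one_le_local_hits[OF 0(1), of j L 0]
    by (auto intro!: add_nonneg_nonneg mult_nonneg_nonneg simp: add_increasing2)
next
  case (Suc m)
  have K: "0 \<le> K" using p0(1) hit_nonneg by (simp add: K_def)
  let ?Phi = "\<lambda>m V x. local_hits j L m V x + K * (1 - local_survival j m V x)"
  show ?case
  proof (cases "reach (j + L) V")
    case True
    have "0 \<le> K * (1 - local_survival j (Suc m) V x)"
      using K local_survival_bounds[of j "Suc m" V x] by simp
    moreover have "1 \<le> local_hits j L (Suc m) V x" by (rule one_le_local_hits[OF Suc.prems(1) True])
    ultimately show ?thesis using True by (simp only: weighted_hit_reach)
  next
    case nr: False
    have "hit (j + L) (Suc m) V x = (\<Sum>y\<in>neighbours b x. move V x y * hit (j + L) m (insert y V) y)"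
      using nr by simp
    also have "\<dots> \<le> (\<Sum>y\<in>neighbours b x. move V x y * ?Phi m (insert y V) y)"
      using Suc.prems by (intro average_mono Suc.IH walk_state_step[OF Suc.prems(1)]) auto
    also have "\<dots> \<le> ?Phi (Suc m) V x"
    proof (cases "j \<le> length x")
      case False
      have Phi_x: "?Phi (Suc m) V x = (\<Sum>z\<in>level j V. hit L (Suc m) (below V z) []) + K"
        using False by (simp add: local_hits_def local_survival_def pos_short level_def del: weighted_hit.simps)
      show ?thesis
      proof (rule average_le)
        fix y assume y: "y \<in> neighbours b x"
        have len: "length y \<le> j" using neighbour_length[OF y] False by simp
        have mono: "(\<Sum>z\<in>level j V. hit L m (below V z) []) \<le> (\<Sum>z\<in>level j V. hit L (Suc m) (below V z) [])"
          by (intro sum_mono hit_mono_time) simp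
        show "?Phi m (insert y V) y \<le> ?Phi (Suc m) V x"
        proof (cases "length y < j \<or> y \<in> V")
          case True
          have lev: "level j (insert y V) = level j V" using True by (auto simp: level_def)
          have bel: "below (insert y V) z = below V z" if "z \<in> level j V" for z
            using True that below_insert_short[of y z V] by (auto simp: insert_absorb level_def)
          have "local_hits j L m (insert y V) y = (\<Sum>z\<in>level j V. hit L m (below V z) [])"
            unfolding local_hits_def lev using bel len by (intro sum.cong) (auto simp: pos_short level_def)
          moreover have "K * (1 - local_survival j m (insert y V) y) \<le> K"
            using K local_survival_bounds(1)[of j m "insert y V" y] by (simp add: algebra_simps)
          ultimately show ?thesis unfolding Phi_x using mono by linarith
        next
          case False
          then have y_len: "length y = j" and new: "y \<notin> V" using len by auto
          have below_y: "below (insert y V) y = {[]}"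
            using new walk_state_suffix[OF Suc.prems(1), of _ y] by (auto simp: below_def)
          have lev: "level j (insert y V) = insert y (level j V)" "y \<notin> level j V"
            using new y_len by (auto simp: level_def)
          have "local_hits j L m (insert y V) y = hit L m {[]} [] + (\<Sum>z\<in>level j V. hit L m (below (insert y V) z) (pos z y))"
            unfolding local_hits_def lev(1)
            using lev(2) finite_level[OF Suc.prems(1)] by (simp add: below_y)
          also have "(\<Sum>z\<in>level j V. hit L m (below (insert y V) z) (pos z y)) = (\<Sum>z\<in>level j V. hit L m (below V z) [])"
          proof (rule sum.cong)
            fix z' assume "z' \<in> level j V"
            then have "length y = length z'" "y \<noteq> z'" using y_len lev(2) by (auto simp: level_def)
            then show "hit L m (below (insert y V) z') (pos z' y) = hit L m (below V z') []"
              using below_insert_other[of y z' "[]" V] by (simp add: pos_short)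
          qed simp
          finally have a: "local_hits j L m (insert y V) y = hit L m {[]} [] + (\<Sum>z\<in>level j V. hit L m (below V z) [])" .
          have "K * p0 \<le> K * local_survival j m (insert y V) y"
            using local_survival_append[OF y_len, of m "insert y V" "[]"] p0(2)[of m] K
            by (intro mult_left_mono) (simp_all add: below_y)
          moreover have "hit L m {[]} [] \<le> K * p0"
            using p0(1) hit_mono_time[of m T L "{[]}" "[]"] Suc.prems by (simp add: K_def)
          ultimately show ?thesis unfolding Phi_x a using mono by (simp add: algebra_simps)
        qed
      qed
    next
      case True
      then obtain u z where uz: "x = u @ z" and z_len: "length z = j"
        using split_at_level by blast
      have "z \<noteq> []" using z_len \<open>0 < j\<close> by auto
      note cl = Suc.prems(1)[unfolded uz]
      have z: "z \<in> level j V" using walk_state_suffix[OF cl] cl z_len by (auto simp: level_def walk_state_def)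
      have tlz: "insert (tl z) V = V"
        using z \<open>z \<noteq> []\<close> cl by (auto simp: level_def walk_state_def)
      let ?B = "below V z"
      define s where "s = stay ?B u"
      define R where "R = (\<Sum>z'\<in>level j V - {z}. hit L (Suc m) (below V z') [])"
      define H where "H = hit L (Suc m) ?B u"
      define Sv where "Sv = (\<Sum>w\<in>neighbours b u. move ?B u w * survival m (insert w ?B) w)"
      have s: "0 \<le> s" "s \<le> 1" using stay_nonneg stay_le_1 by (auto simp: s_def)
      have R: "(\<Sum>z'\<in>level j V - {z}. hit L m (below V z') []) \<le> R"
        unfolding R_def by (intro sum_mono hit_mono_time) simp
      have "\<not> reach L ?B" using nr reach_below[of L V z] z_len by auto
      then have H_eq: "H = (\<Sum>w\<in>neighbours b u. move ?B u w * hit L m (insert w ?B) w)"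
        by (simp add: H_def)
      have inside: "?Phi m (insert (w @ z) V) (w @ z)
          \<le> R + (hit L m (insert w ?B) w + K * (1 - survival m (insert w ?B) w))" for w
        using R by (simp add: local_hits_inside[OF cl z_len] local_survival_append[OF z_len] below_insert)
      have "(\<Sum>w\<in>neighbours b u. move ?B u w * ?Phi m (insert (w @ z) V) (w @ z))
         \<le> (\<Sum>w\<in>neighbours b u. move ?B u w * (R + (hit L m (insert w ?B) w + K * (1 - survival m (insert w ?B) w))))"
        by (rule average_mono) (rule inside)
      also have "\<dots> = (\<Sum>w\<in>neighbours b u. move ?B u w * R + move ?B u w * hit L m (insert w ?B) w
          + move ?B u w * K - K * (move ?B u w * survival m (insert w ?B) w))"
        by (intro sum.cong) (auto simp: algebra_simps)
      also have "\<dots> = R + H + K - K * Sv"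
        unfolding H_eq Sv_def sum_distrib_left
        by (simp add: sum.distrib sum_subtractf sum_distrib_right[symmetric] sum_move)
      finally have stays: "(\<Sum>w\<in>neighbours b u. move ?B u w * ?Phi m (insert (w @ z) V) (w @ z))
         \<le> R + H + K - K * Sv" .
      \<comment> \<open>Steps out of the subtree occur only from \<open>z\<close>, that is for \<open>u = []\<close>; otherwise \<open>1 - s\<close> vanishes.\<close>
      have exit: "(1 - s) * ?Phi m V (tl z) \<le> (1 - s) * (R + H + K)"
      proof (cases "u = []")
        case True
        have "length (tl z) < j" using z_len \<open>0 < j\<close> by simp
        then have "local_hits j L m V (tl z) = (\<Sum>z'\<in>level j V. hit L m (below V z') [])"
          "local_survival j m V (tl z) = 0"
          unfolding local_hits_def local_survival_def
          by (auto simp: pos_short level_def intro!: sum.cong)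
        moreover have "(\<Sum>z'\<in>level j V. hit L m (below V z') [])
           = hit L m ?B [] + (\<Sum>z'\<in>level j V - {z}. hit L m (below V z') [])"
          by (rule sum.remove[OF finite_level[OF cl] z])
        moreover have "hit L m ?B [] \<le> H"
          unfolding H_def True by (rule hit_mono_time) simp
        ultimately have "?Phi m V (tl z) \<le> R + H + K" using R by simp
        then show ?thesis using s by (intro mult_left_mono) auto
      next
        case False
        then show ?thesis by (simp add: s_def stay_not_root)
      qed
      have "(\<Sum>y\<in>neighbours b x. move V x y * ?Phi m (insert y V) y)
        = s * (\<Sum>w\<in>neighbours b u. move ?B u w * ?Phi m (insert (w @ z) V) (w @ z)) + (1 - s) * ?Phi m V (tl z)"
        unfolding uz s_def
        using average_subtree[OF \<open>z \<noteq> []\<close>, of V u "\<lambda>y. ?Phi m (insert y V) y"] by (simp only: tlz)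
      also have "\<dots> \<le> s * (R + H + K - K * Sv) + (1 - s) * (R + H + K)"
        by (intro add_mono mult_left_mono stays exit s(1))
      also have "\<dots> = R + H + K * (1 - s * Sv)" by (simp add: algebra_simps)
      also have "\<dots> = ?Phi (Suc m) V x"
      proof -
        have "?B = insert u ?B" using cl by (auto simp: below_def walk_state_def)
        then have "local_hits j L (Suc m) V x = H + R"
          using local_hits_inside[OF cl z_len, of L "Suc m" u] cl
          by (simp add: uz H_def R_def insert_absorb walk_state_def del: weighted_hit.simps)
        moreover have "local_survival j (Suc m) V x = s * Sv"
          by (simp add: uz local_survival_append[OF z_len] s_def Sv_def)
        ultimately show ?thesis by simp
      qed
      finally show ?thesis .
    qed
    finally show ?thesis .
  qed
qed

text \<open>The bound does not depend on the history, except that \<open>z\<close> is at a height reached for the first time.\<close>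

lemma hit_from_record:
  assumes p0: "0 < p0" "\<And>n. p0 \<le> survival n {[]} []"
    and cl: "walk_state (insert z V) z" and new: "\<not> reach (length z) V"
  shows "hit (length z + L) m (insert z V) z \<le> hit L m {[]} [] / p0"
proof (cases "z = []")
  case True
  then have V: "V = {}" using new by (auto simp: reach_def)
  have "hit L m {[]} [] * p0 \<le> hit L m {[]} [] * 1"
    using p0(2)[of 0] by (intro mult_left_mono hit_nonneg) simp
  then show ?thesis using True V p0(1) by (simp add: field_simps)
next
  case False
  let ?V = "insert z V" and ?d = "hit L m {[]} []"
  have bz: "below ?V z = {[]}" by (rule below_new_record[OF new])
  have lev: "level (length z) ?V = {z}" using new by (auto simp: level_def reach_def)
  have "hit (length z + L) m ?V z
     \<le> local_hits (length z) L m ?V z + ?d / p0 * (1 - local_survival (length z) m ?V z)"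
    using False by (intro hit_le_local_hits[OF p0 _ cl]) auto
  also have "local_hits (length z) L m ?V z = ?d"
    unfolding local_hits_def lev by (simp add: bz)
  also have "local_survival (length z) m ?V z = survival m {[]} []"
    using local_survival_append[OF refl, of z m ?V "[]"] by (simp add: bz)
  also have "?d + ?d / p0 * (1 - survival m {[]} []) \<le> ?d + ?d / p0 * (1 - p0)"
    using p0 hit_nonneg by (intro add_left_mono mult_left_mono) auto
  also have "\<dots> = ?d / p0" using p0(1) by (simp add: field_simps)
  finally show ?thesis .
qed

text \<open>
  If \<open>J\<close> is reached after time \<open>t\<close>, the bound for the remaining ascent is \<open>B * exp (\<theta> * (n - t))\<close>. This is
  estimated by \<open>B * exp (\<theta> * n)\<close> if \<open>t \<le> m\<close> and has the additional factor \<open>exp (- \<theta> * m)\<close> otherwise.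
\<close>

lemma hit_restart_at_record:
  assumes rec: "\<And>V z n. walk_state (insert z V) z \<Longrightarrow> length z = J \<Longrightarrow> \<not> reach J V \<Longrightarrow>
      hit K n (insert z V) z \<le> B * exp (\<theta> * real n)"
    and "0 \<le> B" "0 \<le> \<theta>" "J \<le> K" and "walk_state V x" "\<not> reach J V"
  shows "hit K n V x \<le> B * exp (\<theta> * real n) * (hit J m V x + exp (- \<theta> * real m))"
  using assms(5,6)
proof (induction n arbitrary: m V x)
  case 0
  then have "\<not> reach K V" using reach_mono \<open>J \<le> K\<close> by blast
  then show ?case using assms(2) hit_nonneg[of J m V x] by simp
next
  case (Suc n)
  have nr: "\<not> reach K V" using Suc.prems reach_mono \<open>J \<le> K\<close> by blast
  let ?B = "B * exp (\<theta> * real (Suc n))"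
  have B: "0 \<le> ?B" "B * exp (\<theta> * real n) \<le> ?B"
    using assms(2,3) by (auto intro!: mult_left_mono)
  have new: "hit K n (insert y V) y \<le> ?B" if y: "y \<in> neighbours b x" and "reach J (insert y V)" for y
  proof -
    have len: "length y = J" using reach_insert_step Suc.prems y that by (auto simp: walk_state_def)
    show ?thesis
      using rec[OF walk_state_step[OF Suc.prems(1) y] len Suc.prems(2), of n] B(2) by linarith
  qed
  have x: "hit K (Suc n) V x = (\<Sum>y\<in>neighbours b x. move V x y * hit K n (insert y V) y)"
    using nr by simp
  show ?case
  proof (cases m)
    case 0
    have "hit K n (insert y V) y \<le> ?B" if y: "y \<in> neighbours b x" for y
    proof (cases "reach J (insert y V)")
      case False
      then show ?thesis
        using Suc.IH[OF walk_state_step[OF Suc.prems(1) y] False, of 0] B(2) by simp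
    qed (use new y in auto)
    then have "hit K (Suc n) V x \<le> ?B" unfolding x by (rule average_le)
    then show ?thesis using 0 Suc.prems by simp
  next
    case m: (Suc m')
    let ?e = "exp (- \<theta> * real m)"
    have "hit K n (insert y V) y \<le> ?B * (hit J m' (insert y V) y + ?e)" if y: "y \<in> neighbours b x" for y
    proof (cases "reach J (insert y V)")
      case True
      have "?B * 1 \<le> ?B * (hit J m' (insert y V) y + ?e)"
        using True by (intro mult_left_mono B(1)) (simp add: weighted_hit_reach)
      then show ?thesis using new[OF y True] by linarith
    next
      case False
      have "hit K n (insert y V) y \<le> B * exp (\<theta> * real n) * (hit J m' (insert y V) y + exp (- \<theta> * real m'))"
        by (rule Suc.IH[OF walk_state_step[OF Suc.prems(1) y] False])
      also have "\<dots> = B * exp (\<theta> * real n) * hit J m' (insert y V) y + ?B * ?e"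
        by (simp add: m distrib_left distrib_right exp_add[symmetric] mult.assoc algebra_simps)
      also have "\<dots> \<le> ?B * hit J m' (insert y V) y + ?B * ?e"
        by (intro add_right_mono mult_right_mono B(2) hit_nonneg)
      finally show ?thesis by (simp add: distrib_left)
    qed
    then have "hit K (Suc n) V x
       \<le> (\<Sum>y\<in>neighbours b x. move V x y * (?B * (hit J m' (insert y V) y + ?e)))"
      unfolding x by (rule average_mono)
    also have "\<dots> = ?B * ((\<Sum>y\<in>neighbours b x. move V x y * hit J m' (insert y V) y)
        + (\<Sum>y\<in>neighbours b x. move V x y) * ?e)"
      by (simp only: distrib_left sum.distrib sum_distrib_left sum_distrib_right mult_ac)
    finally show ?thesis using Suc.prems by (simp add: sum_move m)
  qed
qed

text \<open>
  Each block of \<open>L\<close> levels contributes the factor \<open>\<rho>\<close>: it is crossed within time \<open>m\<close> with probability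
  at most \<open>hit L m {[]} [] / p0\<close>, or it takes longer and gains \<open>exp (- \<theta> * m)\<close>.
\<close>

lemma hit_blocks:
  fixes L m :: nat and p0 \<theta> :: real
  assumes p0: "0 < p0" "\<And>n. p0 \<le> survival n {[]} []" and "0 < L" "0 \<le> \<theta>"
  defines "\<rho> \<equiv> hit L m {[]} [] / p0 + exp (- \<theta> * real m)"
  shows "hit (r * L) n {[]} [] \<le> \<rho> ^ r * exp (\<theta> * real n)"
proof -
  have \<rho>: "0 \<le> \<rho>" unfolding \<rho>_def using p0(1) hit_nonneg by (auto intro!: add_nonneg_nonneg divide_nonneg_nonneg)
  have "hit (length z + r * L) n (insert z V) z \<le> \<rho> ^ r * exp (\<theta> * real n)"
    if "walk_state (insert z V) z" "\<not> reach (length z) V" for V z n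
    using that
  proof (induction r arbitrary: V z n)
    case 0
    have "1 \<le> exp (\<theta> * real n)" using \<open>0 \<le> \<theta>\<close> by simp
    moreover have "hit (length z) n (insert z V) z \<le> 1" by (rule hit_le_1)
    ultimately have "hit (length z) n (insert z V) z \<le> exp (\<theta> * real n)" by linarith
    then show ?case by simp
  next
    case (Suc r)
    let ?J = "length z + L" and ?V = "insert z V"
    have "\<not> reach ?J ?V"
      using Suc.prems(2) reach_mono[of ?J V "length z"] \<open>0 < L\<close> by (auto simp: reach_def)
    moreover have "hit (length z + Suc r * L) n (insert z' V') z' \<le> \<rho> ^ r * exp (\<theta> * real n)"
      if "walk_state (insert z' V') z'" "length z' = ?J" "\<not> reach ?J V'" for V' z' n
      using Suc.IH[OF that(1), of n] that(2,3) by (simp add: add.assoc)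
    ultimately have "hit (length z + Suc r * L) n ?V z
        \<le> \<rho> ^ r * exp (\<theta> * real n) * (hit ?J m ?V z + exp (- \<theta> * real m))"
      using \<rho> \<open>0 \<le> \<theta>\<close> Suc.prems(1) by (intro hit_restart_at_record[where J = ?J]) auto
    also have "\<dots> \<le> \<rho> ^ r * exp (\<theta> * real n) * \<rho>"
      using hit_from_record[OF p0 Suc.prems, of L m] \<rho>
      by (intro mult_left_mono) (auto simp: \<rho>_def)
    finally show ?case by (simp add: mult_ac)
  qed
  from this[of "[]" "{}" n] show ?thesis by (simp add: walk_state_def reach_def)
qed

section \<open>The law of the trajectory\<close>

abbreviation "M \<equiv> orrw b c"

lemma prob_space_M: "prob_space M" by (rule prob_space_orrw)

lemma M_cylinder:
  "measure M {\<omega>. \<forall>i\<le>n. \<omega> i = x i} = (if x 0 = [] then \<Prod>i<n. step_prob b c x i (x (Suc i)) else 0)"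
proof -
  have "0 \<le> step_prob b c x i y" for i y
    using pmf_nonneg[of "orrw_step b c (Suc i) x" y] pmf_orrw_step_Suc[of b c i x y] b_ge_2 c_pos
    by (simp del: orrw_step.simps)
  then have "0 \<le> (if x 0 = [] then \<Prod>i<n. step_prob b c x i (x (Suc i)) else 0)"
    by (auto intro: prod_nonneg)
  then show ?thesis
    unfolding measure_def
    using emeasure_orrw_cylinder[of b c n x] b_ge_2 c_pos by (simp del: prod_ennreal)
qed

lemma measurable_coordinate [measurable]: "(\<lambda>\<omega>. \<omega> i) \<in> measurable M (count_space UNIV)"
proof -
  have "(\<lambda>\<omega>. \<omega> i) \<in> measurable (PiM UNIV (\<lambda>_. count_space UNIV)) (count_space UNIV)"
    by measurable
  then show ?thesis by (subst measurable_cong_sets[OF sets_orrw refl])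
qed

text \<open>
  Lists of vertices form a countable type, unlike sets of vertices; measurability of functions of the
  visited set is therefore derived through the path.
\<close>

definition path :: "nat \<Rightarrow> (nat \<Rightarrow> vertex) \<Rightarrow> vertex list" where
  "path n \<omega> = map \<omega> [0..<n]"

lemma path_eq_iff: "path n \<omega> = path n x \<longleftrightarrow> (\<forall>i<n. \<omega> i = x i)"
  by (auto simp: path_def)

lemma measurable_path [measurable]: "path n \<in> measurable M (count_space UNIV)"
proof (subst measurable_count_space_eq2_countable, safe)
  fix l :: "vertex list"
  have "path n \<omega> = l \<longleftrightarrow> length l = n \<and> (\<forall>i<n. \<omega> i = l ! i)" for \<omega>
    unfolding path_def by (subst list_eq_iff_nth_eq) auto
  then have "path n -` {l} \<inter> space M = {\<omega> \<in> space M. length l = n \<and> (\<forall>i<n. \<omega> i = l ! i)}"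
    by (simp add: vimage_def)
  also have "\<dots> \<in> sets M" by measurable
  finally show "path n -` {l} \<inter> space M \<in> sets M" .
qed simp_all

lemma borel_measurable_path: "(\<lambda>\<omega>. F (path n \<omega>)) \<in> borel_measurable M" for F :: "vertex list \<Rightarrow> real"
  by (rule measurable_compose[OF measurable_path]) simp

lemma image_path: "\<omega> ` {..n} = set (path (Suc n) \<omega>)"
proof -
  have "{..n} = set [0..<Suc n]" by auto
  then show ?thesis by (simp only: path_def set_map)
qed

lemma last_path: "\<omega> n = last (path (Suc n) \<omega>)"
  by (simp add: path_def)

lemma measurable_state:
  "(\<lambda>\<omega>. F (\<omega> ` {..i}) (\<omega> i)) \<in> borel_measurable M" for F :: "vertex set \<Rightarrow> vertex \<Rightarrow> real"
proof -
  have "(\<lambda>\<omega>. F (\<omega> ` {..i}) (\<omega> i)) = (\<lambda>\<omega>. F (set (path (Suc i) \<omega>)) (last (path (Suc i) \<omega>)))"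
    by (simp only: image_path[symmetric] last_path[symmetric])
  then show ?thesis using borel_measurable_path[of "\<lambda>l. F (set l) (last l)"] by simp
qed

text \<open>
  The first visit to \<open>v\<close> must come from its parent: the other neighbours of \<open>v\<close> are its children, and
  the first visit to a child comes, inductively, from \<open>v\<close>.
\<close>

lemma visited_tl:
  assumes "\<omega> 0 = []" "\<And>i. i < n \<Longrightarrow> \<omega> (Suc i) \<in> neighbours b (\<omega> i)" "v \<in> \<omega> ` {..n}" "v \<noteq> []"
  shows "\<exists>i<n. {\<omega> i, \<omega> (Suc i)} = {tl v, v}"
  using assms(2-4)
proof (induction n arbitrary: v)
  case 0
  then show ?case using assms(1) by auto
next
  case (Suc n)
  show ?case
  proof (cases "v \<in> \<omega> ` {..n}")
    case True
    then have "\<exists>i<n. {\<omega> i, \<omega> (Suc i)} = {tl v, v}"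
      using Suc.prems by (intro Suc.IH) auto
    then show ?thesis using less_Suc_eq by blast
  next
    case False
    then have v: "v = \<omega> (Suc n)" using Suc.prems(2) by (auto simp: atMost_Suc)
    have n: "v \<in> neighbours b (\<omega> n)" using Suc.prems(1)[of n] v by simp
    show ?thesis
    proof (cases "\<omega> n = tl v")
      case True
      then show ?thesis using v by auto
    next
      case tl: False
      then have *: "\<omega> n \<noteq> []" "v = tl (\<omega> n)" using n by (auto simp: neighbours_def split: if_splits)
      have "\<exists>i<n. {\<omega> i, \<omega> (Suc i)} = {tl (\<omega> n), \<omega> n}"
        using Suc.prems * by (intro Suc.IH) auto
      then obtain i where "i < n" "v \<in> {\<omega> i, \<omega> (Suc i)}" using * by auto
      then have "v \<in> \<omega> ` {..n}" by auto
      then show ?thesis using False by simp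
    qed
  qed
qed

lemma step_prob_eq_move:
  assumes "x 0 = []" "\<And>i. i < k \<Longrightarrow> x (Suc i) \<in> neighbours b (x i)" "y \<in> neighbours b (x k)"
  shows "step_prob b c x k y = move (x ` {..k}) (x k) y"
proof -
  have "edge_weight c x k (x k) z = weight (x ` {..k}) (x k) z" if z: "z \<in> neighbours b (x k)" for z
  proof (cases "x k \<noteq> [] \<and> z = tl (x k)")
    case True
    then show ?thesis
      using visited_tl[of x k "x k", OF assms(1,2)] by (auto simp: edge_weight_def weight_def insert_commute)
  next
    case False
    then obtain i where i: "z = i # x k" using z by (auto simp: neighbours_def split: if_splits)
    have "z \<noteq> tl (x k)" using i by (auto dest: arg_cong[where f = length])
    moreover have "(\<exists>i<k. {x i, x (Suc i)} = {x k, z}) \<longleftrightarrow> z \<in> x ` {..k}"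
    proof
      assume "z \<in> x ` {..k}"
      then show "\<exists>i<k. {x i, x (Suc i)} = {x k, z}"
        using visited_tl[of x k z, OF assms(1,2)] i by auto
    next
      assume "\<exists>i<k. {x i, x (Suc i)} = {x k, z}"
      then obtain i where "i < k" "z \<in> {x i, x (Suc i)}" by auto
      then show "z \<in> x ` {..k}" by auto
    qed
    ultimately show ?thesis by (simp add: edge_weight_def weight_def)
  qed
  then show ?thesis
    using assms(3) by (simp add: step_prob_def move_def total_weight_def cong: sum.cong)
qed

abbreviation cylinder :: "nat \<Rightarrow> (nat \<Rightarrow> vertex) \<Rightarrow> (nat \<Rightarrow> vertex) set" where
  "cylinder n x \<equiv> {\<omega>. \<forall>i\<le>n. \<omega> i = x i}"

lemma cylinder_eq_path: "cylinder n x = {\<omega>. path (Suc n) \<omega> = path (Suc n) x}"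
  by (auto simp: path_eq_iff less_Suc_eq_le)

lemma sets_cylinder: "cylinder n x \<in> sets M"
proof -
  have "path (Suc n) -` {path (Suc n) x} \<inter> space M \<in> sets M"
    by (rule measurable_sets[OF measurable_path]) simp
  then show ?thesis unfolding cylinder_eq_path by (simp add: vimage_def)
qed

text \<open>There are only countably many paths of each length, so those of probability 0 can be discarded together.\<close>

lemma AE_cylinder: "AE \<omega> in M. \<forall>n. measure M (cylinder n \<omega>) \<noteq> 0"
proof -
  interpret prob_space M by (rule prob_space_M)
  have "AE \<omega> in M. \<forall>l. path (Suc n) \<omega> = l \<longrightarrow> measure M {\<omega>'. path (Suc n) \<omega>' = l} \<noteq> 0" for n
  proof (subst AE_all_countable, safe)
    fix l
    show "AE \<omega> in M. path (Suc n) \<omega> = l \<longrightarrow> measure M {\<omega>'. path (Suc n) \<omega>' = l} \<noteq> 0"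
    proof (cases "measure M {\<omega>'. path (Suc n) \<omega>' = l} = 0")
      case True
      have "path (Suc n) -` {l} \<inter> space M \<in> sets M"
        by (rule measurable_sets[OF measurable_path]) simp
      then have "{\<omega>'. path (Suc n) \<omega>' = l} \<in> null_sets M"
        using True by (auto simp: vimage_def null_sets_def emeasure_eq_measure)
      then show ?thesis by (rule AE_I') auto
    qed simp
  qed
  then show ?thesis by (simp add: AE_all_countable cylinder_eq_path)
qed

lemma cylinder_path:
  assumes "measure M (cylinder n x) \<noteq> 0"
  shows "x 0 = []" "\<And>i. i < n \<Longrightarrow> x (Suc i) \<in> neighbours b (x i)"
proof -
  show "x 0 = []" using assms unfolding M_cylinder by (auto split: if_splits)
  fix i assume "i < n"
  moreover have "(\<Prod>i<n. step_prob b c x i (x (Suc i))) \<noteq> 0"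
    using assms unfolding M_cylinder by (auto split: if_splits)
  ultimately have "step_prob b c x i (x (Suc i)) \<noteq> 0" by auto
  then show "x (Suc i) \<in> neighbours b (x i)" by (auto simp: step_prob_def split: if_splits)
qed

lemma AE_walk: "AE \<omega> in M. \<omega> 0 = [] \<and> (\<forall>i. \<omega> (Suc i) \<in> neighbours b (\<omega> i))"
  using AE_cylinder
proof eventually_elim
  case (elim \<omega>)
  then show ?case using cylinder_path(1)[of 0 \<omega>] cylinder_path(2)[of "Suc _" \<omega>] by blast
qed

lemma measure_cylinder_step:
  assumes "y \<in> neighbours b (x k)"
  shows "measure M (cylinder (Suc k) (x(Suc k := y))) = measure M (cylinder k x) * move (x ` {..k}) (x k) y"
proof -
  let ?x = "x(Suc k := y)"
  have same: "step_prob b c ?x i (?x (Suc i)) = step_prob b c x i (?x (Suc i))" if "i \<le> k" for i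
  proof -
    have "edge_weight c ?x i = edge_weight c x i"
      using that by (auto simp: edge_weight_def fun_eq_iff)
    then show ?thesis using that by (simp add: step_prob_def)
  qed
  have "measure M (cylinder (Suc k) ?x) = measure M (cylinder k x) * step_prob b c x k y"
  proof -
    have "(\<Prod>i<k. step_prob b c ?x i (?x (Suc i))) = (\<Prod>i<k. step_prob b c x i (x (Suc i)))"
    proof (rule prod.cong)
      fix i assume "i \<in> {..<k}"
      then show "step_prob b c ?x i (?x (Suc i)) = step_prob b c x i (x (Suc i))"
        using same[of i] by simp
    qed simp
    moreover have "step_prob b c ?x k (?x (Suc k)) = step_prob b c x k y"
      using same[of k] by simp
    ultimately show ?thesis unfolding M_cylinder by (simp del: fun_upd_apply) (simp add: fun_upd_apply)
  qed
  moreover have "step_prob b c x k y = move (x ` {..k}) (x k) y" if "measure M (cylinder k x) \<noteq> 0"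
    using cylinder_path[OF that] assms by (intro step_prob_eq_move) auto
  ultimately show ?thesis by auto
qed

text \<open>
  The Markov property in integrated form. Conditioning on the whole past, as a cylinder, lets the
  induction proceed by splitting the cylinder according to the next position.
\<close>

lemma has_integral_cylinder:
  "has_bochner_integral M
     (\<lambda>\<omega>. indicator (cylinder k x) \<omega> *
       ((\<Prod>i=k..<k + n. g (\<omega> ` {..i}) (\<omega> i)) * f (\<omega> ` {..k + n}) (\<omega> (k + n))))
     (measure M (cylinder k x) * weighted_exp g f n (x ` {..k}) (x k))"
proof (induction n arbitrary: k x)
  interpret prob_space M by (rule prob_space_M)
  case 0
  have img: "\<omega> ` {..k} = x ` {..k}" if "\<omega> \<in> cylinder k x" for \<omega> using that by auto
  have "has_bochner_integral M (\<lambda>\<omega>. indicator (cylinder k x) \<omega> * f (x ` {..k}) (x k))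
     (measure M (cylinder k x) * f (x ` {..k}) (x k))"
    using sets_cylinder by (intro has_bochner_integral_mult_left has_bochner_integral_real_indicator)
      (auto simp: emeasure_eq_measure)
  also have "(\<lambda>\<omega>. indicator (cylinder k x) \<omega> * f (x ` {..k}) (x k))
     = (\<lambda>\<omega>. indicator (cylinder k x) \<omega> * f (\<omega> ` {..k}) (\<omega> k))"
  proof
    fix \<omega>
    show "indicator (cylinder k x) \<omega> * f (x ` {..k}) (x k) = indicator (cylinder k x) \<omega> * f (\<omega> ` {..k}) (\<omega> k)"
    proof (cases "\<omega> \<in> cylinder k x")
      case True
      then have "\<omega> k = x k" by simp
      then show ?thesis using img[OF True] by simp
    qed simp
  qed
  finally show ?case by simp
next
  case (Suc n)
  let ?N = "neighbours b (x k)" and ?x = "\<lambda>y. x(Suc k := y)" and ?g = "g (x ` {..k}) (x k)"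
  let ?I = "\<lambda>n k x \<omega>. indicator (cylinder k x) \<omega> *
       ((\<Prod>i=k..<k + n. g (\<omega> ` {..i}) (\<omega> i)) * f (\<omega> ` {..k + n}) (\<omega> (k + n)))"
  have meas: "?I n k x \<in> borel_measurable M" for n k x
    by (intro borel_measurable_times borel_measurable_prod measurable_state
        borel_measurable_indicator sets_cylinder)
  have img: "?x y ` {..Suc k} = insert y (x ` {..k})" for y
    by (auto simp: atMost_Suc)
  have "has_bochner_integral M (\<lambda>\<omega>. ?g * (\<Sum>y\<in>?N. ?I n (Suc k) (?x y) \<omega>))
    (?g * (\<Sum>y\<in>?N. measure M (cylinder (Suc k) (?x y)) * weighted_exp g f n (?x y ` {..Suc k}) (?x y (Suc k))))"
    by (intro has_bochner_integral_mult_right has_bochner_integral_sum Suc)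
  also have "?g * (\<Sum>y\<in>?N. measure M (cylinder (Suc k) (?x y)) * weighted_exp g f n (?x y ` {..Suc k}) (?x y (Suc k)))
     = ?g * (\<Sum>y\<in>?N. measure M (cylinder k x) * (move (x ` {..k}) (x k) y * weighted_exp g f n (insert y (x ` {..k})) y))"
    by (simp only: img measure_cylinder_step fun_upd_same mult.assoc cong: sum.cong)
  also have "\<dots> = measure M (cylinder k x) * weighted_exp g f (Suc n) (x ` {..k}) (x k)"
    by (simp add: sum_distrib_left mult_ac)
  finally have *: "has_bochner_integral M (\<lambda>\<omega>. ?g * (\<Sum>y\<in>?N. ?I n (Suc k) (?x y) \<omega>))
    (measure M (cylinder k x) * weighted_exp g f (Suc n) (x ` {..k}) (x k))" .
  have "AE \<omega> in M. ?I (Suc n) k x \<omega> = ?g * (\<Sum>y\<in>?N. ?I n (Suc k) (?x y) \<omega>)"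
    using AE_walk
  proof eventually_elim
    case (elim \<omega>)
    have cyl: "\<omega> \<in> cylinder (Suc k) (?x y) \<longleftrightarrow> \<omega> \<in> cylinder k x \<and> y = \<omega> (Suc k)" for y
      by (auto simp: le_Suc_eq)
    show ?case
    proof (cases "\<omega> \<in> cylinder k x")
      case False
      then have "\<omega> \<notin> cylinder (Suc k) (?x y)" for y using cyl by blast
      then show ?thesis
        using False by (simp only: indicator_def of_bool_eq(1) mult_zero_left mult_zero_right sum.neutral_const)
    next
      case True
      let ?J = "(\<Prod>i=Suc k..<Suc k + n. g (\<omega> ` {..i}) (\<omega> i)) * f (\<omega> ` {..Suc k + n}) (\<omega> (Suc k + n))"
      have g: "?g = g (\<omega> ` {..k}) (\<omega> k)" using True by (auto intro!: arg_cong2[where f = g])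
      have "\<omega> k = x k" using True by simp
      then have mem: "\<omega> (Suc k) \<in> ?N" using elim by metis
      have "(\<Sum>y\<in>?N. ?I n (Suc k) (?x y) \<omega>) = (\<Sum>y\<in>?N. if y = \<omega> (Suc k) then ?J else 0)"
        using cyl True by (intro sum.cong) (auto simp: indicator_def)
      also have "\<dots> = ?J" using mem by simp
      finally have "?g * (\<Sum>y\<in>?N. ?I n (Suc k) (?x y) \<omega>) = g (\<omega> ` {..k}) (\<omega> k) * ?J" by (simp only: g)
      also have "\<dots> = ?I (Suc n) k x \<omega>"
        using True by (simp add: prod.atLeast_Suc_lessThan mult.assoc)
      finally show ?thesis by (rule sym)
    qed
  qed
  moreover have "(\<lambda>\<omega>. ?g * (\<Sum>y\<in>?N. ?I n (Suc k) (?x y) \<omega>)) \<in> borel_measurable M"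
    by (intro borel_measurable_times borel_measurable_const borel_measurable_sum meas)
  ultimately show ?case
    using * has_bochner_integral_cong_AE[OF meas[where n = "Suc n" and k = k and x = x]] by blast
qed

lemma has_integral_weighted_exp:
  "has_bochner_integral M (\<lambda>\<omega>. (\<Prod>i<n. g (\<omega> ` {..i}) (\<omega> i)) * f (\<omega> ` {..n}) (\<omega> n)) (weighted_exp g f n {[]} [])"
proof -
  interpret prob_space M by (rule prob_space_M)
  let ?C = "cylinder 0 (\<lambda>_. [])"
  have C: "measure M ?C = 1" unfolding M_cylinder by simp
  have *: "has_bochner_integral M (\<lambda>\<omega>. indicator ?C \<omega> *
      ((\<Prod>i<n. g (\<omega> ` {..i}) (\<omega> i)) * f (\<omega> ` {..n}) (\<omega> n))) (weighted_exp g f n {[]} [])"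
    using has_integral_cylinder[where k = 0 and x = "\<lambda>_. []" and n = n and g = g and f = f] C by (simp add: atLeast0LessThan)
  have meas: "(\<lambda>\<omega>. (\<Prod>i<n. g (\<omega> ` {..i}) (\<omega> i)) * f (\<omega> ` {..n}) (\<omega> n)) \<in> borel_measurable M"
    by (intro borel_measurable_times borel_measurable_prod measurable_state)
  have "AE \<omega> in M. indicator ?C \<omega> * ((\<Prod>i<n. g (\<omega> ` {..i}) (\<omega> i)) * f (\<omega> ` {..n}) (\<omega> n))
     = (\<Prod>i<n. g (\<omega> ` {..i}) (\<omega> i)) * f (\<omega> ` {..n}) (\<omega> n)"
    using AE_walk by eventually_elim (simp add: indicator_def)
  then show ?thesis
    using * has_bochner_integral_cong_AE[OF borel_measurable_has_bochner_integral[OF *] meas] by blast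
qed

lemma prob_state: "measure M {\<omega>. P (\<omega> ` {..n}) (\<omega> n)} = weighted_exp (\<lambda>_ _. 1) (\<lambda>V x. of_bool (P V x)) n {[]} []"
proof -
  have "has_bochner_integral M (\<lambda>\<omega>. of_bool (P (\<omega> ` {..n}) (\<omega> n)))
      (weighted_exp (\<lambda>_ _. 1) (\<lambda>V x. of_bool (P V x)) n {[]} [])"
    using has_integral_weighted_exp[where g = "\<lambda>_ _. 1" and n = n and f = "\<lambda>V x. of_bool (P V x)"] by simp
  moreover have "(\<lambda>\<omega>. of_bool (P (\<omega> ` {..n}) (\<omega> n)) :: real) = indicator {\<omega>. P (\<omega> ` {..n}) (\<omega> n)}"
    by (auto simp: fun_eq_iff indicator_def)
  ultimately show ?thesis
    using has_bochner_integral_integral_eq by fastforce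
qed

lemma sets_state: "{\<omega>. P (\<omega> ` {..n}) (\<omega> n)} \<in> sets M"
proof -
  have "{\<omega> \<in> space M. (of_bool (P (\<omega> ` {..n}) (\<omega> n)) :: real) = 1} \<in> sets M"
    by (rule borel_measurable_eq[OF measurable_state borel_measurable_const, of "\<lambda>V x. of_bool (P V x)"])
  moreover have "(of_bool Q :: real) = 1 \<longleftrightarrow> Q" for Q by auto
  ultimately show ?thesis by simp
qed

text \<open>
  Up to time \<open>n\<close> the killed walk survives with conditional probability at least \<open>r ^ N\<close> given the
  trajectory, where \<open>r = b / (b + c)\<close> and \<open>N\<close> is the number of visits to the root; and with
  probability greater than 1/2, \<open>N \<le> K\<close> for a suitable \<open>K\<close>.
\<close>

lemma survival_ge_p0:
  assumes "AE \<omega> in M. \<exists>K. \<forall>i\<ge>K. \<omega> i \<noteq> []"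
  obtains p0 where "0 < p0" "\<And>n. p0 \<le> survival n {[]} []"
proof -
  interpret prob_space M by (rule prob_space_M)
  define A where "A K = {\<omega> :: nat \<Rightarrow> vertex. \<forall>i\<ge>K. \<omega> i \<noteq> []}" for K :: nat
  have A_sets: "A K \<in> sets M" for K
  proof -
    have "{\<omega> \<in> space M. \<forall>i\<ge>K. \<omega> i \<noteq> []} \<in> sets M" by measurable
    then show ?thesis by (simp add: A_def)
  qed
  have "(\<lambda>K. prob (A K)) \<longlonglongrightarrow> prob (\<Union>K. A K)"
    using A_sets by (intro finite_Lim_measure_incseq) (auto simp: incseq_def A_def)
  moreover have "prob (\<Union>K. A K) = 1"
  proof (subst prob_eq_1)
    show "AE \<omega> in M. \<omega> \<in> (\<Union>K. A K)" using assms by (simp add: A_def)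
  qed (use A_sets in auto)
  ultimately have "\<forall>\<^sub>F K in sequentially. 1/2 < prob (A K)"
    by (intro order_tendstoD(1)) auto
  then obtain K where K: "1/2 < prob (A K)" by (auto simp: eventually_sequentially)
  define r where "r = real b / (real b + c)"
  have r: "0 < r" "r \<le> 1" using b_ge_2 c_pos by (auto simp: r_def)
  have "r ^ K * prob (A K) \<le> survival n {[]} []" for n
  proof -
    let ?g = "\<lambda>(_::vertex set) x::vertex. if x = [] then r else 1"
    have "has_bochner_integral M (\<lambda>\<omega>. r ^ K * indicator (A K) \<omega>) (r ^ K * prob (A K))"
      using A_sets by (intro has_bochner_integral_mult_right has_bochner_integral_real_indicator)
        (auto simp: emeasure_eq_measure)
    moreover have "has_bochner_integral M (\<lambda>\<omega>. (\<Prod>i<n. if \<omega> i = [] then r else 1)) (weighted_exp ?g (\<lambda>_ _. 1) n {[]} [])"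
      using has_integral_weighted_exp[where g = ?g and n = n and f = "\<lambda>_ _. 1"] by simp
    moreover have "r ^ K * indicator (A K) \<omega> \<le> (\<Prod>i<n. if \<omega> i = [] then r else 1)" for \<omega>
    proof (cases "\<omega> \<in> A K")
      case True
      have "r ^ K \<le> r ^ card ({..<n} \<inter> {i. i < K})"
      proof (rule power_decreasing)
        have "card ({..<n} \<inter> {i. i < K}) \<le> card {..<K}" by (intro card_mono) auto
        then show "card ({..<n} \<inter> {i. i < K}) \<le> K" by simp
      qed (use r in auto)
      also have "\<dots> = (\<Prod>i<n. if i < K then r else 1)" by (simp add: prod.If_cases)
      also have "\<dots> \<le> (\<Prod>i<n. if \<omega> i = [] then r else 1)"
        using True r by (intro prod_mono) (auto simp: A_def not_less)
      finally show ?thesis using True by simp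
    next
      case False
      then show ?thesis using r by (auto intro!: prod_nonneg)
    qed
    ultimately have "r ^ K * prob (A K) \<le> weighted_exp ?g (\<lambda>_ _. 1) n {[]} []"
      by (metis (no_types, lifting) has_bochner_integral_iff integral_mono)
    also have "\<dots> \<le> survival n {[]} []"
      using r stay_ge[folded r_def] by (intro weighted_exp_mono) (auto simp: stay_not_root)
    finally show ?thesis .
  qed
  moreover have "0 < r ^ K * prob (A K)" using r K by simp
  ultimately show ?thesis using that by blast
qed

text \<open>
  Almost surely \<open>height (\<omega> i) < a * i\<close> for all large \<open>i\<close>, so that height \<open>L\<close> cannot be attained at a time
  \<open>i \<le> L / a\<close> once \<open>L\<close> exceeds the heights attained at the finitely many other times.
\<close>

lemma hit_fast_tendsto_0:
  assumes speed: "AE \<omega> in M. (\<lambda>n. real (height (\<omega> n)) / real n) \<longlonglongrightarrow> S" and "S < a" "0 < a"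
  shows "(\<lambda>L. hit L (nat \<lfloor>real L / a\<rfloor>) {[]} []) \<longlonglongrightarrow> 0"
proof -
  interpret prob_space M by (rule prob_space_M)
  define m where "m L = nat \<lfloor>real L / a\<rfloor>" for L :: nat
  have m: "real (m L) * a \<le> real L" for L
  proof -
    have "real (m L) \<le> real L / a" unfolding m_def using \<open>0 < a\<close> by (simp add: of_nat_nat)
    then show ?thesis using \<open>0 < a\<close> by (simp add: field_simps)
  qed
  have hit: "hit L (m L) {[]} [] = (\<integral>\<omega>. of_bool (reach L (\<omega> ` {..m L})) \<partial>M)" for L
    unfolding hit_eq_weighted_exp
    using has_bochner_integral_integral_eq[OF has_integral_weighted_exp[where g = "\<lambda>_ _. 1" and n = "m L" and f = "\<lambda>V _. of_bool (reach L V)"]]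
    by simp
  have "(\<lambda>L. \<integral>\<omega>. of_bool (reach L (\<omega> ` {..m L})) \<partial>M) \<longlonglongrightarrow> (\<integral>\<omega>. (0::real) \<partial>M)"
  proof (rule integral_dominated_convergence[where w = "\<lambda>_. 1"])
    show "AE \<omega> in M. (\<lambda>L. of_bool (reach L (\<omega> ` {..m L})) :: real) \<longlonglongrightarrow> 0"
      using speed
    proof eventually_elim
      case (elim \<omega>)
      then have "\<forall>\<^sub>F i in sequentially. real (height (\<omega> i)) / real i < a"
        using \<open>S < a\<close> by (rule order_tendstoD(2))
      then obtain I where I: "\<And>i. I \<le> i \<Longrightarrow> real (height (\<omega> i)) / real i < a"
        by (auto simp: eventually_sequentially)
      let ?H = "\<Sum>i\<le>I. height (\<omega> i)"
      have not_reached: "\<not> reach L (\<omega> ` {..m L})" if L: "?H < L" for L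
      proof
        assume "reach L (\<omega> ` {..m L})"
        then obtain i where i: "i \<le> m L" "L \<le> height (\<omega> i)" by (auto simp: reach_def height_def)
        have "I < i"
        proof (rule ccontr)
          assume "\<not> I < i"
          then have "height (\<omega> i) \<le> ?H" by (intro member_le_sum) auto
          then show False using i L by simp
        qed
        then have "real (height (\<omega> i)) < a * real i" using I[of i] by (simp add: field_simps)
        also have "\<dots> \<le> a * real (m L)" using i \<open>0 < a\<close> by simp
        also have "\<dots> \<le> real L" using m[of L] by (simp add: mult.commute)
        finally show False using i by simp
      qed
      have "\<forall>\<^sub>F L in sequentially. (of_bool (reach L (\<omega> ` {..m L})) :: real) = 0"
        by (rule eventually_mono[OF eventually_gt_at_top[of ?H]]) (simp add: not_reached)
      then show ?case by (rule tendsto_eventually)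
    qed
    show "(\<lambda>\<omega>. of_bool (reach L (\<omega> ` {..m L})) :: real) \<in> borel_measurable M" for L
      by (rule measurable_state[of "\<lambda>V _. of_bool (reach L V)"])
  qed auto
  then show ?thesis by (simp add: hit[unfolded m_def] m_def)
qed

section \<open>The rate\<close>

lemma upper_tail_rate:
  assumes "0 < S" and speed: "AE \<omega> in M. (\<lambda>n. real (height (\<omega> n)) / real n) \<longlonglongrightarrow> S"
    and "S < a" "a \<le> 1"
  shows "\<exists>\<beta>::real. \<beta> > 0 \<and>
    (\<lambda>n. - 1 / real n * ln (measure M {\<omega> \<in> space M. real (height (\<omega> n)) \<ge> a * real n})) \<longlonglongrightarrow> \<beta>"
proof -
  have a: "0 < a" using assms by simp
  have "AE \<omega> in M. \<exists>K. \<forall>i\<ge>K. \<omega> i \<noteq> []"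
    using speed
  proof eventually_elim
    case (elim \<omega>)
    then have "\<forall>\<^sub>F i in sequentially. 0 < real (height (\<omega> i)) / real i"
      using \<open>0 < S\<close> by (rule order_tendstoD(1))
    then obtain K where "\<And>i. K \<le> i \<Longrightarrow> 0 < real (height (\<omega> i)) / real i"
      by (auto simp: eventually_sequentially)
    then show ?case by (intro exI[of _ K]) (fastforce simp: height_def)
  qed
  then obtain p0 where p0: "0 < p0" "\<And>n. p0 \<le> survival n {[]} []" using survival_ge_p0 by blast
  define k where "k n = nat \<lceil>a * real n\<rceil>" for n
  have k_iff: "k n \<le> h \<longleftrightarrow> a * real n \<le> real h" for n h
    unfolding k_def by (rule nat_ceiling_le_eq)
  have k_le: "k n \<le> n" for n using a \<open>a \<le> 1\<close> by (simp add: k_iff mult_left_le_one_le)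
  have k_ge: "a * real n \<le> real (k n)" for n using k_iff[of n "k n"] by simp
  have k_add: "k (m + n) \<le> k m + k n" for m n
    using k_ge[of m] k_ge[of n] by (simp add: k_iff distrib_left)
  have k_pos: "0 < k n" if "0 < n" for n
    using k_ge[of n] a that by (metis less_le_trans mult_pos_pos of_nat_0_less_iff)
  define q where "q n = Q (k n) n" for n
  define u where "u n = - ln (q n)" for n
  have q: "0 < q n" "q n \<le> 1" for n unfolding q_def using Q_pos k_le Q_le_1 by auto
  have "0 \<le> u n" for n using q by (simp add: u_def)
  moreover have "u (m + n) \<le> u m + u n" for m n
  proof -
    have "q m * q n \<le> Q (k m + k n) (m + n)" unfolding q_def by (rule Q_supermult)
    also have "\<dots> \<le> q (m + n)" unfolding q_def by (rule Q_mono[OF k_add order.refl])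
    finally have "ln (q m * q n) \<le> ln (q (m + n))" using q by simp
    then show ?thesis using q[of m] q[of n] by (simp add: u_def ln_mult)
  qed
  ultimately obtain \<beta> where \<beta>: "(\<lambda>n. u n / real n) \<longlonglongrightarrow> \<beta>" using subadditive_limit by blast
  define H where "H n = hit (k n) n {[]} []" for n
  have qH: "q n \<le> H n" for n
    unfolding q_def Q_def H_def by (rule weighted_hit_mono_factor) (simp_all add: stay_nonneg stay_le_1)
  have Hq: "H n \<le> loop_cost ^ Suc (budget h {[]} n) * q n" if "0 < h" for n h
    using hit_le_killed_hit[OF that, of "[]" "{[]}" "k n" n] by (simp add: H_def q_def Q_def)
  define f where "f n = measure M {\<omega> \<in> space M. real (height (\<omega> n)) \<ge> a * real n}" for n
  have f_eq: "f n = measure M {\<omega>. (\<lambda>_ x. k n \<le> length x) (\<omega> ` {..n}) (\<omega> n)}" for n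
    by (simp add: f_def k_iff height_def)
  have fH: "f n \<le> H n" for n
  proof -
    interpret prob_space M by (rule prob_space_M)
    have "f n \<le> measure M {\<omega>. (\<lambda>V _. reach (k n) V) (\<omega> ` {..n}) (\<omega> n)}"
      unfolding f_eq by (intro finite_measure_mono sets_state) (auto simp: reach_def)
    then show ?thesis
      using prob_state[of "\<lambda>V _. reach (k n) V" n] by (simp add: H_def hit_eq_weighted_exp)
  qed
  have Hf: "p0 * H n \<le> f n" if "0 < n" for n
    unfolding f_eq prob_state[of "\<lambda>_ x. k n \<le> length x" n] H_def
    using k_pos[OF that] by (intro end_height_ge p0) (auto simp: reach_def)
  \<comment> \<open>The two error terms are the two parts of the budget divided by \<open>n\<close>; the second becomes small only with large \<open>h\<close>.\<close>
  have lower: "u n / real n - (real (card (Tree h)) + 1) * ln loop_cost / real n - ln loop_cost / real h \<le> - 1 / real n * ln (f n)"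
    if "0 < n" "0 < h" for n h
  proof -
    have pos: "0 < f n" using Hf[OF that(1)] qH[of n] q[of n] p0(1)
      by (meson less_le_trans mult_pos_pos)
    have lnD: "0 \<le> ln loop_cost" using loop_cost_ge_1 by simp
    have "f n \<le> loop_cost ^ Suc (budget h {[]} n) * q n" using fH Hq[OF that(2)] by (rule order_trans)
    then have "ln (f n) \<le> ln (loop_cost ^ Suc (budget h {[]} n) * q n)" using pos by simp
    also have "\<dots> = real (Suc (budget h {[]} n)) * ln loop_cost - u n"
      using q[of n] loop_cost_ge_1 by (subst ln_mult) (auto simp: u_def ln_realpow simp del: power_Suc)
    also have "real (Suc (budget h {[]} n)) * ln loop_cost \<le> (real (card (Tree h)) + 1 + real n / real h) * ln loop_cost"
    proof (intro mult_right_mono lnD)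
      have "card (Tree h - {[]}) \<le> card (Tree h)" by (intro card_mono) (auto simp: finite_Tree)
      moreover have "real (n div h) \<le> real n / real h" by (rule of_nat_div_le_of_nat)
      ultimately show "real (Suc (budget h {[]} n)) \<le> real (card (Tree h)) + 1 + real n / real h"
        by (simp add: budget_def)
    qed
    finally have "u n - (real (card (Tree h)) + 1) * ln loop_cost - real n * (ln loop_cost / real h) \<le> - ln (f n)"
      by (simp add: algebra_simps add_divide_distrib)
    then have "(u n - (real (card (Tree h)) + 1) * ln loop_cost - real n * (ln loop_cost / real h)) / real n \<le> - ln (f n) / real n"
      by (rule divide_right_mono) simp
    then show ?thesis using that(1) by (simp add: diff_divide_distrib)
  qed
  have upper: "- 1 / real n * ln (f n) \<le> u n / real n - ln p0 / real n" if "0 < n" for n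
  proof -
    have "p0 * q n \<le> p0 * H n" using p0(1) qH by (intro mult_left_mono) auto
    also have "\<dots> \<le> f n" by (rule Hf[OF that])
    finally have "ln (p0 * q n) \<le> ln (f n)" using p0(1) q[of n] by (intro ln_mono) auto
    then have "- ln (f n) \<le> u n - ln p0" using p0(1) q[of n] by (simp add: ln_mult u_def)
    then have "- ln (f n) / real n \<le> (u n - ln p0) / real n" by (rule divide_right_mono) simp
    then show ?thesis by (simp add: diff_divide_distrib)
  qed
  have conv: "(\<lambda>n. - 1 / real n * ln (f n)) \<longlonglongrightarrow> \<beta>"
  proof (rule LIMSEQ_I)
    fix e :: real assume e: "0 < e"
    have inv: "(\<lambda>n. C / real n) \<longlonglongrightarrow> 0" for C :: real
      by (rule lim_const_over_n)
    have "\<forall>\<^sub>F h in sequentially. ln loop_cost / real h < e / 3"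
      using e by (intro order_tendstoD(2)[OF inv]) auto
    then obtain h where h: "0 < h" "ln loop_cost / real h < e / 3"
      using eventually_gt_at_top[of 0] by (metis (mono_tags, lifting) eventually_conj eventually_happens' sequentially_bot)
    have "\<forall>\<^sub>F n in sequentially. (real (card (Tree h)) + 1) * ln loop_cost / real n < e / 3"
      using e by (intro order_tendstoD(2)[OF inv]) auto
    moreover have "\<forall>\<^sub>F n in sequentially. - ln p0 / real n < e / 3"
      using e by (intro order_tendstoD(2)[OF inv]) auto
    moreover have "\<forall>\<^sub>F n in sequentially. \<beta> - e / 3 < u n / real n"
      using e by (intro order_tendstoD(1)[OF \<beta>]) auto
    moreover have "\<forall>\<^sub>F n in sequentially. u n / real n < \<beta> + e / 3"
      using e by (intro order_tendstoD(2)[OF \<beta>]) auto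
    moreover note eventually_gt_at_top[of 0]
    ultimately have "\<forall>\<^sub>F n in sequentially. norm (- 1 / real n * ln (f n) - \<beta>) < e"
    proof eventually_elim
      case (elim n)
      then show ?case
        using lower[OF elim(5) h(1)] upper[OF elim(5)] h(2) unfolding real_norm_def abs_less_iff by linarith
    qed
    then show "\<exists>no. \<forall>n\<ge>no. norm (- 1 / real n * ln (f n) - \<beta>) < e"
      by (simp add: eventually_sequentially)
  qed
  have "0 < \<beta>"
  proof -
    define a' where "a' = (S + a) / 2"
    have a': "S < a'" "a' < a" "0 < a'" using assms by (auto simp: a'_def)
    define m where "m L = nat \<lfloor>real L / a'\<rfloor>" for L :: nat
    \<comment> \<open>\<open>\<theta> = 1 / L\<close> keeps both exponents per block bounded: \<open>\<theta> m\<close>, which tends to \<open>1 / a'\<close>, outweighs the share \<open>\<theta> L / a = 1 / a\<close> of \<open>\<theta> n\<close>.\<close>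
    define \<rho> where "\<rho> L = hit L (m L) {[]} [] / p0 + exp (- (1 / real L) * real (m L))" for L
    have "(\<lambda>L. real (m L) / real L) \<longlonglongrightarrow> 1 / a'"
    proof (rule tendsto_sandwich[of "\<lambda>L. 1 / a' - 1 / real L" _ _ "\<lambda>L. 1 / a'"])
      have m_bounds: "real L / a' - 1 \<le> real (m L)" "real (m L) \<le> real L / a'" for L
        unfolding m_def using a' by (auto simp: of_nat_nat)
      show "\<forall>\<^sub>F L in sequentially. 1 / a' - 1 / real L \<le> real (m L) / real L"
        using eventually_gt_at_top[of 0]
      proof eventually_elim
        case (elim L)
        have "1 / a' - 1 / real L = (real L / a' - 1) / real L" using elim by (simp add: diff_divide_distrib)
        also have "\<dots> \<le> real (m L) / real L" using m_bounds by (intro divide_right_mono) auto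
        finally show ?case .
      qed
      show "\<forall>\<^sub>F L in sequentially. real (m L) / real L \<le> 1 / a'"
        using eventually_gt_at_top[of 0]
      proof eventually_elim
        case (elim L)
        then show ?case using m_bounds(2)[of L] a' by (simp add: field_simps)
      qed
      show "(\<lambda>L. 1 / a' - 1 / real L) \<longlonglongrightarrow> 1 / a'"
        using tendsto_diff[OF tendsto_const lim_const_over_n[of 1]] by simp
    qed simp
    then have "(\<lambda>L. exp (- (real (m L) / real L))) \<longlonglongrightarrow> exp (- (1 / a'))"
      by (intro tendsto_exp tendsto_minus)
    moreover have "(\<lambda>L. hit L (m L) {[]} [] / p0) \<longlonglongrightarrow> 0 / p0"
      unfolding m_def using p0(1) by (intro tendsto_divide hit_fast_tendsto_0[OF speed] a' tendsto_const) auto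
    ultimately have "(\<lambda>L. \<rho> L * exp (1 / a)) \<longlonglongrightarrow> (0 / p0 + exp (- (1 / a'))) * exp (1 / a)"
      unfolding \<rho>_def by (intro tendsto_mult tendsto_add tendsto_const) (simp_all add: mult.commute)
    also have "(0 / p0 + exp (- (1 / a'))) * exp (1 / a) = exp (1 / a - 1 / a')"
      by (simp add: exp_add[symmetric])
    finally have lim: "(\<lambda>L. \<rho> L * exp (1 / a)) \<longlonglongrightarrow> exp (1 / a - 1 / a')" .
    have "1 / a < 1 / a'" using a' a by (simp add: field_simps)
    then have "exp (1 / a - 1 / a') < 1" by simp
    then have "\<forall>\<^sub>F L in sequentially. \<rho> L * exp (1 / a) < 1" by (rule order_tendstoD(2)[OF lim])
    then obtain L where L: "0 < L" "\<rho> L * exp (1 / a) < 1"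
      using eventually_gt_at_top[of 0] by (metis (mono_tags, lifting) eventually_conj eventually_happens' sequentially_bot)
    have \<rho>: "0 < \<rho> L"
      unfolding \<rho>_def using p0(1) hit_nonneg by (intro add_nonneg_pos divide_nonneg_nonneg) auto
    have "ln (\<rho> L * exp (1 / a)) < 0" using L(2) \<rho> by (intro ln_less_zero) auto
    then have ln_lt: "ln (\<rho> L) + 1 / a < 0" using \<rho> by (simp add: ln_mult)
    then have ln_neg: "ln (\<rho> L) < 0" using a by (smt (verit) divide_pos_pos)
    have bound: "(- ln (\<rho> L)) * (a / real L) - 1 / real L + ln (\<rho> L) / real n \<le> u n / real n" if "0 < n" for n
    proof -
      define r where "r = k n div L"
      have "r * L \<le> k n" by (simp add: r_def)
      then have "q n \<le> hit (r * L) n {[]} []"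
        using qH[of n] weighted_hit_antimono_height[of "\<lambda>_ _. 1" "r * L" "k n" n "{[]}" "[]"]
        by (simp add: H_def)
      also have "\<dots> \<le> \<rho> L ^ r * exp (1 / real L * real n)"
        unfolding \<rho>_def using L(1) by (intro hit_blocks p0) auto
      finally have "ln (q n) \<le> ln (\<rho> L ^ r * exp (1 / real L * real n))" using q by (intro ln_mono) auto
      also have "\<dots> = real r * ln (\<rho> L) + real n / real L"
        using \<rho> by (simp add: ln_mult ln_realpow)
      finally have 1: "real r * (- ln (\<rho> L)) - real n / real L \<le> u n" by (simp add: u_def)
      have "k n < (r + 1) * L"
        unfolding r_def using L(1) by (metis Suc_eq_plus1 dividend_less_div_times mult.commute mult_Suc add.commute)
      then have "real (k n) \<le> (real r + 1) * real L" by (metis less_imp_le of_nat_1 of_nat_add of_nat_le_iff of_nat_mult)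
      then have "a * real n / real L - 1 \<le> real r"
        using k_ge[of n] L(1) by (simp add: field_simps)
      then have "(a * real n / real L - 1) * (- ln (\<rho> L)) \<le> real r * (- ln (\<rho> L))"
        using ln_neg by (intro mult_right_mono) auto
      with 1 have "(a * real n / real L - 1) * (- ln (\<rho> L)) - real n / real L \<le> u n" by linarith
      then have "((a * real n / real L - 1) * (- ln (\<rho> L)) - real n / real L) / real n \<le> u n / real n"
        by (rule divide_right_mono) simp
      moreover have "((a * real n / real L - 1) * (- ln (\<rho> L)) - real n / real L) / real n
          = (- ln (\<rho> L)) * (a / real L) - 1 / real L + ln (\<rho> L) / real n"
        using that L(1) by (simp add: field_simps)
      ultimately show ?thesis by (simp only:)
    qed
    have "(\<lambda>n. (- ln (\<rho> L)) * (a / real L) - 1 / real L + ln (\<rho> L) / real n)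
       \<longlonglongrightarrow> (- ln (\<rho> L)) * (a / real L) - 1 / real L + 0"
      by (intro tendsto_add tendsto_const lim_const_over_n)
    then have "(- ln (\<rho> L)) * (a / real L) - 1 / real L + 0 \<le> \<beta>"
      using bound by (intro tendsto_le[OF _ \<beta>]) (auto intro: eventually_mono[OF eventually_gt_at_top[of 0]])
    moreover have "0 < (- ln (\<rho> L)) * (a / real L) - 1 / real L"
    proof -
      have "(- ln (\<rho> L)) * (a / real L) - 1 / real L = (a / real L) * (- (ln (\<rho> L) + 1 / a))"
        using a L(1) by (simp add: field_simps)
      also have "\<dots> > 0" using ln_lt a L(1) by (intro mult_pos_pos) auto
      finally show ?thesis .
    qed
    ultimately show ?thesis by linarith
  qed
  then show ?thesis using conv unfolding f_def by blast
qed

end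

theorem theorem2:
  fixes b :: nat and c S \<epsilon> :: real
  assumes "b \<ge> 2" and "c > 1"
    and "0 < S" and "S < real b / (real b + c)"
    and "AE \<omega> in orrw b c. (\<lambda>n. real (height (\<omega> n)) / real n) \<longlonglongrightarrow> S"
    and "\<epsilon> > 0" and "S + \<epsilon> \<le> 1"
  shows "\<exists>\<beta>::real. \<beta> > 0 \<and>
    (\<lambda>n. - 1 / real n *
       ln (measure (orrw b c) {\<omega> \<in> space (orrw b c). real (height (\<omega> n)) \<ge> (S + \<epsilon>) * real n}))
      \<longlonglongrightarrow> \<beta>"
proof -
  interpret orrw_chain b c using assms(1,2) by unfold_locales
  show ?thesis using assms by (intro upper_tail_rate[of S]) auto
qed

end
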